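(* The following equivalences hold for quantum circuits (all circuits appearing being well-formed, $q$ a qubit): (1) (Unit) $\mathbf{skip};C\equiv C;\mathbf{skip}\equiv C$. (2) (Identity) $I[\bar q]\equiv\mathbf{skip}$, where $I$ is the identity operator. (3) (Sequential Composition) $U_1[\bar q];U_2[\bar q]\equiv(U_2U_1)[\bar q]$ if $U_2U_1\in\mathcal U$. (4) (Parallel Composition) $U_1[\bar q];U_2[\bar r]\equiv U_2[\bar r];U_1[\bar q]\equiv(U_1\otimes U_2)[\bar q,\bar r]$ if $\bar q\cap\bar r=\emptyset$ and $U_1\otimes U_2\in\mathcal U$. (5) (Commutativity) If $qv(C_1)\cap qv(C_2)=\emptyset$, then $C_1;C_2\equiv C_2;C_1$. (6) (Associativity) $(C_1;C_2);C_3\equiv C_1;(C_2;C_3)$. (7) (Sequentiality) $(C_0\leftarrow q\rightarrow C_1);(D_0\leftarrow q\rightarrow D_1)\equiv(C_0;D_0)\leftarrow q\rightarrow(C_1;D_1)$. (8) (Distributivity over qif) If $q\notin qv(C)$, then $$C;(C_0\leftarrow q\rightarrow C_1)\equiv(C;C_0)\leftarrow q\rightarrow(C;C_1),\qquad (C_0\leftarrow q\rightarrow C_1);C\equiv(C_0;C)\leftarrow q\rightarrow(C_1;C).$$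
   Context: Each quantum variable $q$ has a Hilbert space $\mathcal H_q$. A register $\bar q=q_1,\dots,q_n$ is a finite sequence of distinct variables (identified with its set), with space $\mathcal H_{\bar q}=\bigotimes_i\mathcal H_{q_i}$; $\bar q,\bar r$ denotes concatenation. A set $\mathcal U$ of unitary constants is fixed; $U[\bar q]$ is a basic gate when $U\in\mathcal U$ and its type matches $\bar q$. Circuits: $C::=\mathbf{skip}\mid U[\bar q]\mid C_1;C_2\mid \mathbf{qif}\,[\bar q](\square_{i=1}^d|\psi_i\rangle\to C_i)\,\mathbf{fiq}$, where (well-formedness) $\{|\psi_i\rangle\}_{i=1}^d$ is an orthonormal basis of $\mathcal H_{\bar q}$ and $\bar q\cap\bigcup_iqv(C_i)=\emptyset$; $qv(C)$ is the set of variables occurring in $C$. Semantics: $[\![C]\!]$ is the unitary on $\mathcal H_{qv(C)}$ with $[\![\mathbf{skip}]\!]=I$, $[\![U[\bar q]]\!]=U_{\bar q}$, $[\![C_1;C_2]\!]=[\![C_2]\!][\![C_1]\!]$, $[\![\mathbf{qif}\,[\bar q](\square_i|\psi_i\rangle\to C_i)\,\mathbf{fiq}]\!]=\sum_i|\psi_i\rangle_{\bar q}\langle\psi_i|\otimes[\![C_i]\!]$, operators being extended by the identity to all variables of the whole circuit. $C_1\equiv C_2$ iff $[\![C_1]\!]\otimes I_{qv(C_2)\setminus qv(C_1)}=[\![C_2]\!]\otimes I_{qv(C_1)\setminus qv(C_2)}$. For a qubit $q$ with a fixed orthonormal basis $|\varphi_0\rangle,|\varphi_1\rangle$ of $\mathcal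 H_q$ (e.g. the computational basis), the same for all occurrences, $C_0\leftarrow q\rightarrow C_1$ denotes $\mathbf{qif}\,[q](|\varphi_0\rangle\to C_0\ \square\ |\varphi_1\rangle\to C_1)\,\mathbf{fiq}$. *)

theory Defs
  imports "HOL-Analysis.Infinite_Sum" "HOL-Library.FuncSet"
begin

section \<open>Hilbert spaces\<close>

text \<open>
  Every Hilbert space is isometrically isomorphic to the space of square-summable complex
  families over some set of indices, and the tensor product of the spaces over \<open>S\<close> and \<open>T\<close>
  is the space over \<open>S \<times> T\<close>.  All Hilbert spaces below are given in this form; the index
  sets may be infinite.  A vector over \<open>S\<close> is a total function vanishing outside \<open>S\<close>, and an
  operator is a function on vectors that is \<open>undefined\<close> outside its space, so that operators
  on a space are equal iff they agree on it.
\<close>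

type_synonym 'i vec = "'i \<Rightarrow> complex"
type_synonym 'i oper = "'i vec \<Rightarrow> 'i vec"

definition zero_ext :: "'i set \<Rightarrow> 'i vec \<Rightarrow> 'i vec" where
  "zero_ext S f = (\<lambda>s. if s \<in> S then f s else 0)"

definition ell2 :: "'i set \<Rightarrow> 'i vec set" where
  "ell2 S = {\<psi>. (\<forall>s. s \<notin> S \<longrightarrow> \<psi> s = 0) \<and> (\<lambda>s. (cmod (\<psi> s))\<^sup>2) summable_on S}"

definition inner_prod :: "'i set \<Rightarrow> 'i vec \<Rightarrow> 'i vec \<Rightarrow> complex" where
  "inner_prod S \<phi> \<psi> = (\<Sum>\<^sub>\<infinity>s\<in>S. cnj (\<phi> s) * \<psi> s)"

definition orthonormal_basis :: "'i set \<Rightarrow> 'i vec list \<Rightarrow> bool" where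
  "orthonormal_basis S \<phi>s \<longleftrightarrow>
     set \<phi>s \<subseteq> ell2 S \<and>
     (\<forall>i<length \<phi>s. \<forall>j<length \<phi>s. inner_prod S (\<phi>s ! i) (\<phi>s ! j) = (if i = j then 1 else 0)) \<and>
     (\<forall>\<psi>\<in>ell2 S. \<exists>c. \<psi> = (\<lambda>s. \<Sum>i<length \<phi>s. c i * (\<phi>s ! i) s))"

definition linear_on_ell2 :: "'i set \<Rightarrow> 'i oper \<Rightarrow> bool" where
  "linear_on_ell2 S A \<longleftrightarrow>
     (\<forall>\<phi>\<in>ell2 S. \<forall>\<psi>\<in>ell2 S. A (\<lambda>s. \<phi> s + \<psi> s) = (\<lambda>s. A \<phi> s + A \<psi> s)) \<and>
     (\<forall>c. \<forall>\<psi>\<in>ell2 S. A (\<lambda>s. c * \<psi> s) = (\<lambda>s. c * A \<psi> s))"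

definition unitary_on :: "'i set \<Rightarrow> 'i oper \<Rightarrow> bool" where
  "unitary_on S U \<longleftrightarrow>
     U \<in> extensional (ell2 S) \<and> linear_on_ell2 S U \<and> U ` ell2 S = ell2 S \<and>
     (\<forall>\<phi>\<in>ell2 S. \<forall>\<psi>\<in>ell2 S. inner_prod S (U \<phi>) (U \<psi>) = inner_prod S \<phi> \<psi>)"

definition id_op :: "'i set \<Rightarrow> 'i oper" where
  "id_op S = (\<lambda>\<psi>\<in>ell2 S. \<psi>)"

text \<open>The operator \<open>|\<phi>\<rangle>\<langle>\<phi>|\<close>.\<close>

definition proj_op :: "'i set \<Rightarrow> 'i vec \<Rightarrow> 'i oper" where
  "proj_op S \<phi> = (\<lambda>\<psi>\<in>ell2 S. \<lambda>s. inner_prod S \<phi> \<psi> * \<phi> s)"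

text \<open>
  The operator \<open>A \<otimes> B = (A \<otimes> I)(I \<otimes> B)\<close>: first \<open>B\<close> is applied to every slice of the vector
  with fixed first index, then \<open>A\<close> to every slice of the result with fixed second index.
\<close>

definition tensor_op :: "'s set \<Rightarrow> 't set \<Rightarrow> 's oper \<Rightarrow> 't oper \<Rightarrow> ('s \<times> 't) oper" where
  "tensor_op S T A B = (\<lambda>\<psi>\<in>ell2 (S \<times> T). zero_ext (S \<times> T)
     (\<lambda>(s, t). A (zero_ext S (\<lambda>s'. B (zero_ext T (\<lambda>t'. \<psi> (s', t'))) t)) s))"

text \<open>
  Transport of an operator along a bijection \<open>f\<close> from \<open>K\<close> onto the index set of the space on
  which \<open>A\<close> acts.
\<close>

definition relabel :: "'k set \<Rightarrow> ('k \<Rightarrow> 'i) \<Rightarrow> 'i oper \<Rightarrow> 'k oper" where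
  "relabel K f A = (\<lambda>\<psi>\<in>ell2 K. zero_ext K
     (\<lambda>k. A (zero_ext (f ` K) (\<lambda>i. \<psi> (inv_into K f i))) (f k)))"

text \<open>\<open>tensor_op\<close> acts on product vectors as the tensor product of operators must.\<close>

lemma tensor_op_product:
  assumes A: "linear_on_ell2 S A" "A \<phi> \<in> ell2 S" and B: "linear_on_ell2 T B" "B \<chi> \<in> ell2 T"
    and \<phi>: "\<phi> \<in> ell2 S" and \<chi>: "\<chi> \<in> ell2 T" and p: "(\<lambda>(s, t). \<phi> s * \<chi> t) \<in> ell2 (S \<times> T)"
  shows "tensor_op S T A B (\<lambda>(s, t). \<phi> s * \<chi> t) = (\<lambda>(s, t). A \<phi> s * B \<chi> t)"
proof -
  have 1: "zero_ext T (\<lambda>t. \<phi> s * \<chi> t) = (\<lambda>t. \<phi> s * \<chi> t)" for s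
    using \<chi> by (auto simp: zero_ext_def ell2_def)
  have 2: "B (\<lambda>t. \<phi> s * \<chi> t) = (\<lambda>t. \<phi> s * B \<chi> t)" for s
    using B \<chi> by (simp add: linear_on_ell2_def)
  have 3: "zero_ext S (\<lambda>s. \<phi> s * B \<chi> t) = (\<lambda>s. B \<chi> t * \<phi> s)" for t
    using \<phi> by (auto simp: zero_ext_def ell2_def)
  have 4: "A (\<lambda>s. B \<chi> t * \<phi> s) = (\<lambda>s. B \<chi> t * A \<phi> s)" for t
    using A \<phi> by (simp add: linear_on_ell2_def)
  have "tensor_op S T A B (\<lambda>(s, t). \<phi> s * \<chi> t) =
      zero_ext (S \<times> T) (\<lambda>(s, t). B \<chi> t * A \<phi> s)"
    using p by (simp add: tensor_op_def 1 2 3 4)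
  also have "\<dots> = (\<lambda>(s, t). A \<phi> s * B \<chi> t)"
    using A(2) B(2) by (auto simp: zero_ext_def ell2_def fun_eq_iff)
  finally show ?thesis .
qed


section \<open>Unitary constants\<close>

text \<open>
  The type of a constant lists the index sets of the tensor factors of its space; the basis
  of that tensor product is indexed by lists.
\<close>

datatype 'x uconst = UConst (utype: "'x set list") (uop: "'x list oper")

definition uconst_ok :: "'x uconst \<Rightarrow> bool" where
  "uconst_ok U \<longleftrightarrow> unitary_on (listset (utype U)) (uop U)"

definition u_id :: "'x set list \<Rightarrow> 'x uconst" where
  "u_id ts = UConst ts (id_op (listset ts))"

text \<open>The operator product \<open>U V\<close> (\<open>V\<close> first) of constants of equal type.\<close>

definition u_mult :: "'x uconst \<Rightarrow> 'x uconst \<Rightarrow> 'x uconst" where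
  "u_mult U V = UConst (utype V) (compose (ell2 (listset (utype V))) (uop U) (uop V))"

definition u_tensor :: "'x uconst \<Rightarrow> 'x uconst \<Rightarrow> 'x uconst" where
  "u_tensor U V = UConst (utype U @ utype V)
     (relabel (listset (utype U @ utype V))
        (\<lambda>l. (take (length (utype U)) l, drop (length (utype U)) l))
        (tensor_op (listset (utype U)) (listset (utype V)) (uop U) (uop V)))"


section \<open>Circuits\<close>

text \<open>
  A variable \<open>q\<close> has the Hilbert space \<open>ell2 (X q)\<close>.  The vectors guarding the branches of a
  \<open>Qif\<close> on a register \<open>qs\<close> are indexed by lists, as for constants, also if \<open>qs\<close> is a
  single variable.
\<close>

datatype ('v, 'x) circuit =
    Skip
  | Gate "'x uconst" "'v list"
  | Seq "('v, 'x) circuit" "('v, 'x) circuit"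
  | Qif "'v list" "('x list vec \<times> ('v, 'x) circuit) list"

fun qv :: "('v, 'x) circuit \<Rightarrow> 'v set" where
  "qv Skip = {}"
| "qv (Gate U qs) = set qs"
| "qv (Seq C D) = qv C \<union> qv D"
| "qv (Qif qs bs) = set qs \<union> (\<Union>(\<phi>, C)\<in>set bs. qv C)"

abbreviation reg_basis :: "('v \<Rightarrow> 'x set) \<Rightarrow> 'v list \<Rightarrow> 'x list set" where
  "reg_basis X qs \<equiv> listset (map X qs)"

fun well_formed :: "('v \<Rightarrow> 'x set) \<Rightarrow> 'x uconst set \<Rightarrow> ('v, 'x) circuit \<Rightarrow> bool" where
  "well_formed X \<U> Skip \<longleftrightarrow> True"
| "well_formed X \<U> (Gate U qs) \<longleftrightarrow> distinct qs \<and> U \<in> \<U> \<and> utype U = map X qs"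
| "well_formed X \<U> (Seq C D) \<longleftrightarrow> well_formed X \<U> C \<and> well_formed X \<U> D"
| "well_formed X \<U> (Qif qs bs) \<longleftrightarrow>
     distinct qs \<and> orthonormal_basis (reg_basis X qs) (map fst bs) \<and>
     (\<forall>(\<phi>, C)\<in>set bs. well_formed X \<U> C \<and> set qs \<inter> qv C = {})"


section \<open>Semantics\<close>

text \<open>
  The space of a set \<open>V\<close> of variables has the basis \<open>PiE V X\<close> of assignments of basis indices
  to the variables in \<open>V\<close>.
\<close>

abbreviation assigns :: "('v \<Rightarrow> 'x set) \<Rightarrow> 'v set \<Rightarrow> ('v \<Rightarrow> 'x) set" where
  "assigns X V \<equiv> PiE V X"

text \<open>An operator on the tensor product of the spaces of \<open>qs\<close>, placed on these variables.\<close>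

definition on_reg :: "('v \<Rightarrow> 'x set) \<Rightarrow> 'v list \<Rightarrow> 'x list oper \<Rightarrow> ('v \<Rightarrow> 'x) oper" where
  "on_reg X qs A = relabel (assigns X (set qs)) (\<lambda>\<sigma>. map \<sigma> qs) A"

text \<open>Tensor product of operators on disjoint sets \<open>V\<close> and \<open>W\<close> of variables.\<close>

definition var_tensor ::
  "('v \<Rightarrow> 'x set) \<Rightarrow> 'v set \<Rightarrow> 'v set \<Rightarrow> ('v \<Rightarrow> 'x) oper \<Rightarrow> ('v \<Rightarrow> 'x) oper \<Rightarrow> ('v \<Rightarrow> 'x) oper" where
  "var_tensor X V W A B = relabel (assigns X (V \<union> W)) (\<lambda>\<sigma>. (restrict \<sigma> V, restrict \<sigma> W))
     (tensor_op (assigns X V) (assigns X W) A B)"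

text \<open>Extension by the identity on \<open>W - V\<close> of an operator on \<open>V\<close>.\<close>

definition extend :: "('v \<Rightarrow> 'x set) \<Rightarrow> 'v set \<Rightarrow> 'v set \<Rightarrow> ('v \<Rightarrow> 'x) oper \<Rightarrow> ('v \<Rightarrow> 'x) oper" where
  "extend X V W A = var_tensor X V (W - V) A (id_op (assigns X (W - V)))"

fun sem :: "('v \<Rightarrow> 'x set) \<Rightarrow> ('v, 'x) circuit \<Rightarrow> ('v \<Rightarrow> 'x) oper" where
  "sem X Skip = id_op (assigns X {})"
| "sem X (Gate U qs) = on_reg X qs (uop U)"
| "sem X (Seq C D) = compose (ell2 (assigns X (qv C \<union> qv D)))
     (extend X (qv D) (qv C \<union> qv D) (sem X D))
     (extend X (qv C) (qv C \<union> qv D) (sem X C))"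
| "sem X (Qif qs bs) = (let W = (\<Union>(\<phi>, C)\<in>set bs. qv C) in
     (\<lambda>\<psi>\<in>ell2 (assigns X (set qs \<union> W)). \<lambda>\<sigma>.
       sum_list (map (\<lambda>(\<phi>, C). var_tensor X (set qs) W
         (on_reg X qs (proj_op (reg_basis X qs) \<phi>)) (extend X (qv C) W (sem X C)) \<psi> \<sigma>) bs)))"

definition circ_equiv :: "('v \<Rightarrow> 'x set) \<Rightarrow> ('v, 'x) circuit \<Rightarrow> ('v, 'x) circuit \<Rightarrow> bool" where
  "circ_equiv X C D \<longleftrightarrow>
     var_tensor X (qv C) (qv D - qv C) (sem X C) (id_op (assigns X (qv D - qv C))) =
     var_tensor X (qv D) (qv C - qv D) (sem X D) (id_op (assigns X (qv C - qv D)))"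

definition qubit :: "('v \<Rightarrow> 'x set) \<Rightarrow> 'v \<Rightarrow> bool" where
  "qubit X q \<longleftrightarrow> card (X q) = 2"

abbreviation qif2 ::
  "'x list vec \<Rightarrow> 'x list vec \<Rightarrow> 'v \<Rightarrow> ('v, 'x) circuit \<Rightarrow> ('v, 'x) circuit \<Rightarrow> ('v, 'x) circuit" where
  "qif2 \<phi>0 \<phi>1 q C0 C1 \<equiv> Qif [q] [(\<phi>0, C0), (\<phi>1, C1)]"

end

theory Submission
  imports Defs "HOL-Analysis.L2_Norm"
begin

text \<open>
  Place the semantics of a circuit on any larger set of variables by letting it act on the slices
  of a vector.  This is functorial, so sequencing becomes composition and a \<open>Qif\<close> becomes
  \<open>\<Sum>\<^sub>i P\<^sub>i C\<^sub>i\<close> with orthogonal projections \<open>P\<^sub>i\<close>, and two circuits are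
  equivalent iff their actions on the common variables agree.  The laws then follow from
  \<open>P\<^sub>i P\<^sub>j = 0\<close> for \<open>i \<noteq> j\<close>, \<open>P\<^sub>i P\<^sub>i = P\<^sub>i\<close>, linearity, and the fact
  that operators on disjoint sets of variables commute.  In infinite dimension the last point needs
  boundedness: a bounded operator is given by a square-summable kernel, which turns both
  composites into the same absolutely convergent double sum.
\<close>

section \<open>Square-summable families\<close>

text \<open>Unitarity is too strong an invariant: one branch of a \<open>Qif\<close> is a projection
  tensored with an operator, which is in general not unitary. Boundedness survives tensoring,
  composition and finite sums, so it is what the induction on circuits carries. Linearity would be
  too weak. On an infinite index set a linear operator is not determined by its values on the basis
  vectors, since a square-summable vector is only a limit of finite combinations of them; equations
  cannot be checked on product vectors alone, and slicewise action of a discontinuous operator may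
  even leave \<open>ell2\<close>. Boundedness supplies the continuity that makes each coordinate of
  \<open>A \<psi>\<close> an inner product with a fixed row. The norm is kept squared throughout:
  squared norms add up over the slices of a vector, so a bound on slices becomes a bound on the
  whole vector with the same constant.\<close>

definition sqnorm :: "'i set \<Rightarrow> 'i vec \<Rightarrow> real" where
  "sqnorm S \<psi> = (\<Sum>\<^sub>\<infinity>s\<in>S. (cmod (\<psi> s))\<^sup>2)"

lemma ell2_summable: "\<psi> \<in> ell2 S \<Longrightarrow> (\<lambda>s. (cmod (\<psi> s))\<^sup>2) summable_on S"
  by (simp add: ell2_def)

lemma ell2_outside: "\<psi> \<in> ell2 S \<Longrightarrow> s \<notin> S \<Longrightarrow> \<psi> s = 0"
  by (simp add: ell2_def)

lemma zero_ext_in_ell2_iff: "zero_ext S f \<in> ell2 S \<longleftrightarrow> (\<lambda>s. (cmod (f s))\<^sup>2) summable_on S"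
  by (auto simp: ell2_def zero_ext_def cong: summable_on_cong)

lemma sqnorm_nonneg: "0 \<le> sqnorm S \<psi>"
  by (simp add: sqnorm_def infsum_nonneg)

text \<open>The triangle inequality fails for squares;
  \<open>2 * x * y \<le> x\<^sup>2 + y\<^sup>2\<close> replaces it at the price of a factor 2. The
  factor is harmless because only the existence of bounds is ever used.\<close>

lemma cmod_add_power2_le: "(cmod (a + b))\<^sup>2 \<le> 2 * (cmod a)\<^sup>2 + 2 * (cmod b)\<^sup>2"
proof -
  have "(cmod (a + b))\<^sup>2 \<le> (cmod a + cmod b)\<^sup>2"
    by (simp add: norm_triangle_ineq power_mono)
  also have "\<dots> \<le> 2 * (cmod a)\<^sup>2 + 2 * (cmod b)\<^sup>2"
    using sum_squares_bound[of "cmod a" "cmod b"] by (simp add: power2_sum)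
  finally show ?thesis .
qed

lemma
  assumes "\<phi> \<in> ell2 S" "\<psi> \<in> ell2 S"
  shows ell2_add: "(\<lambda>s. \<phi> s + \<psi> s) \<in> ell2 S"
    and sqnorm_add: "sqnorm S (\<lambda>s. \<phi> s + \<psi> s) \<le> 2 * sqnorm S \<phi> + 2 * sqnorm S \<psi>"
proof -
  have sum: "(\<lambda>s. 2 * (cmod (\<phi> s))\<^sup>2 + 2 * (cmod (\<psi> s))\<^sup>2) summable_on S"
    using assms by (intro summable_on_add summable_on_cmult_right ell2_summable)
  then have sum': "(\<lambda>s. (cmod (\<phi> s + \<psi> s))\<^sup>2) summable_on S"
    by (rule summable_on_comparison_test) (auto simp: cmod_add_power2_le)
  then show "(\<lambda>s. \<phi> s + \<psi> s) \<in> ell2 S"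
    using assms by (simp add: ell2_def)
  have "sqnorm S (\<lambda>s. \<phi> s + \<psi> s) \<le> (\<Sum>\<^sub>\<infinity>s\<in>S. 2 * (cmod (\<phi> s))\<^sup>2 + 2 * (cmod (\<psi> s))\<^sup>2)"
    unfolding sqnorm_def by (rule infsum_mono[OF sum' sum]) (rule cmod_add_power2_le)
  also have "\<dots> = 2 * sqnorm S \<phi> + 2 * sqnorm S \<psi>"
    using assms unfolding sqnorm_def
    by (subst infsum_add) (auto intro!: summable_on_cmult_right ell2_summable simp: infsum_cmult_right')
  finally show "sqnorm S (\<lambda>s. \<phi> s + \<psi> s) \<le> 2 * sqnorm S \<phi> + 2 * sqnorm S \<psi>" .
qed

lemma ell2_scale: "\<psi> \<in> ell2 S \<Longrightarrow> (\<lambda>s. c * \<psi> s) \<in> ell2 S"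
  by (auto simp: ell2_def norm_mult power_mult_distrib intro: summable_on_cmult_right)

lemma sqnorm_scale: "sqnorm S (\<lambda>s. c * \<psi> s) = (cmod c)\<^sup>2 * sqnorm S \<psi>"
  by (simp add: sqnorm_def norm_mult power_mult_distrib infsum_cmult_right')

lemma ell2_zero: "(\<lambda>s. 0) \<in> ell2 S"
  by (simp add: ell2_def)

lemma ell2_truncate:
  assumes "\<psi> \<in> ell2 S" "F \<subseteq> S"
  shows "zero_ext F \<psi> \<in> ell2 S"
proof -
  have "(\<lambda>s. (cmod (zero_ext F \<psi> s))\<^sup>2) summable_on S"
    by (rule summable_on_comparison_test[OF ell2_summable[OF assms(1)]]) (auto simp: zero_ext_def)
  then show ?thesis
    using assms by (auto simp: ell2_def zero_ext_def)
qed

lemma ell2_unit: "s \<in> S \<Longrightarrow> (\<lambda>t. if t = s then 1 else 0) \<in> ell2 S"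
  by (auto simp: ell2_def intro!: finite_nonzero_values_imp_summable_on)

text \<open>Comparison with the sum of the two families of squares. It serves both single inner
  products and the double sum in \<open>lift_lift_commute\<close>.\<close>

lemma abs_summable_on_mult:
  fixes f g :: "'i \<Rightarrow> complex"
  assumes "(\<lambda>i. (cmod (f i))\<^sup>2) summable_on S" "(\<lambda>i. (cmod (g i))\<^sup>2) summable_on S"
  shows "(\<lambda>i. f i * g i) abs_summable_on S"
proof (rule summable_on_comparison_test[OF summable_on_add[OF assms]])
  fix i
  show "norm (f i * g i) \<le> (cmod (f i))\<^sup>2 + (cmod (g i))\<^sup>2"
    using sum_squares_bound[of "cmod (f i)" "cmod (g i)"]
      mult_nonneg_nonneg[OF norm_ge_zero[of "f i"] norm_ge_zero[of "g i"]]
    unfolding norm_mult by linarith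
qed auto

text \<open>The finite Cauchy-Schwarz inequality for \<open>L2_set\<close> bounds every partial sum
  of absolute values by the same number, hence also the infinite sum. The result is squared to match
  \<open>sqnorm\<close>.\<close>

lemma
  assumes "\<phi> \<in> ell2 S" "\<psi> \<in> ell2 S"
  shows inner_prod_abs_summable: "(\<lambda>s. cnj (\<phi> s) * \<psi> s) abs_summable_on S"
    and inner_prod_Cauchy_Schwarz: "(cmod (inner_prod S \<phi> \<psi>))\<^sup>2 \<le> sqnorm S \<phi> * sqnorm S \<psi>"
proof -
  show sum: "(\<lambda>s. cnj (\<phi> s) * \<psi> s) abs_summable_on S"
    by (rule abs_summable_on_mult) (use assms in \<open>auto dest: ell2_summable\<close>)
  have "(\<Sum>\<^sub>\<infinity>s\<in>S. norm (cnj (\<phi> s) * \<psi> s)) \<le> sqrt (sqnorm S \<phi> * sqnorm S \<psi>)"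
  proof (rule infsum_le_finite_sums[OF sum])
    fix F assume F: "finite F" "F \<subseteq> S"
    have "(\<Sum>s\<in>F. norm (cnj (\<phi> s) * \<psi> s)) \<le> L2_set (\<lambda>s. cmod (\<phi> s)) F * L2_set (\<lambda>s. cmod (\<psi> s)) F"
      using L2_set_mult_ineq[of "\<lambda>s. cmod (\<phi> s)" "\<lambda>s. cmod (\<psi> s)" F] by (simp add: norm_mult)
    also have "\<dots> = sqrt ((\<Sum>s\<in>F. (cmod (\<phi> s))\<^sup>2) * (\<Sum>s\<in>F. (cmod (\<psi> s))\<^sup>2))"
      by (simp add: L2_set_def real_sqrt_mult)
    also have "\<dots> \<le> sqrt (sqnorm S \<phi> * sqnorm S \<psi>)"
      unfolding sqnorm_def using assms F
      by (intro real_sqrt_le_mono mult_mono finite_sum_le_infsum ell2_summable infsum_nonneg sum_nonneg) auto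
    finally show "(\<Sum>s\<in>F. norm (cnj (\<phi> s) * \<psi> s)) \<le> sqrt (sqnorm S \<phi> * sqnorm S \<psi>)" .
  qed
  moreover have "cmod (inner_prod S \<phi> \<psi>) \<le> (\<Sum>\<^sub>\<infinity>s\<in>S. norm (cnj (\<phi> s) * \<psi> s))"
    unfolding inner_prod_def by (rule norm_infsum_bound[OF sum])
  ultimately have "cmod (inner_prod S \<phi> \<psi>) \<le> sqrt (sqnorm S \<phi> * sqnorm S \<psi>)"
    by simp
  then have "(cmod (inner_prod S \<phi> \<psi>))\<^sup>2 \<le> (sqrt (sqnorm S \<phi> * sqnorm S \<psi>))\<^sup>2"
    by (intro power_mono) auto
  then show "(cmod (inner_prod S \<phi> \<psi>))\<^sup>2 \<le> sqnorm S \<phi> * sqnorm S \<psi>"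
    by (simp add: sqnorm_nonneg)
qed

lemma inner_prod_summable:
  "\<phi> \<in> ell2 S \<Longrightarrow> \<psi> \<in> ell2 S \<Longrightarrow> (\<lambda>s. cnj (\<phi> s) * \<psi> s) summable_on S"
  by (rule abs_summable_summable[OF inner_prod_abs_summable])

lemma inner_prod_scale: "inner_prod S \<phi> (\<lambda>s. c * \<psi> s) = c * inner_prod S \<phi> \<psi>"
  by (simp add: inner_prod_def mult.left_commute[of _ c] infsum_cmult_right')

lemma inner_prod_add:
  "\<phi> \<in> ell2 S \<Longrightarrow> \<psi> \<in> ell2 S \<Longrightarrow> \<psi>' \<in> ell2 S \<Longrightarrow>
    inner_prod S \<phi> (\<lambda>s. \<psi> s + \<psi>' s) = inner_prod S \<phi> \<psi> + inner_prod S \<phi> \<psi>'"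
  by (simp add: inner_prod_def distrib_left infsum_add inner_prod_summable)

lemma summable_on_complex_of_real_iff:
  "(\<lambda>x. complex_of_real (f x)) summable_on S \<longleftrightarrow> f summable_on S"
  using summable_on_Re[of "\<lambda>x. complex_of_real (f x)" S] summable_on_of_real[of f S] by auto

text \<open>Turns preservation of inner products by a unitary into preservation of the norm. If the
  squares are not summable, both infinite sums have the default value 0, so the equation covers
  every \<open>\<psi>\<close>.\<close>

lemma inner_prod_self: "inner_prod S \<psi> \<psi> = of_real (sqnorm S \<psi>)"
proof -
  have "cnj z * z = of_real ((cmod z)\<^sup>2)" for z
    by (simp add: complex_norm_square mult.commute del: of_real_power)
  then show ?thesis
    unfolding inner_prod_def sqnorm_def
    by (simp add: infsum_bounded_linear_strong[where h = complex_of_real] summable_on_complex_of_real_iff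
        bounded_linear_of_real del: of_real_power)
qed

text \<open>Along an injection the squares form a reindexed subfamily. Slices and relabelled vectors
  are both of this shape.\<close>

lemma ell2_subset_comp:
  assumes "\<psi> \<in> ell2 T" "inj_on g S" "g ` S \<subseteq> T"
  shows "zero_ext S (\<lambda>s. \<psi> (g s)) \<in> ell2 S"
proof -
  have "(\<lambda>t. (cmod (\<psi> t))\<^sup>2) summable_on g ` S"
    using ell2_summable[OF assms(1)] assms(3) by (rule summable_on_subset)
  then have "(\<lambda>s. (cmod (\<psi> (g s)))\<^sup>2) summable_on S"
    using summable_on_reindex[OF assms(2), of "\<lambda>t. (cmod (\<psi> t))\<^sup>2"] by (simp add: o_def)
  then show ?thesis
    by (simp add: zero_ext_in_ell2_iff)
qed


section \<open>Bounded operators\<close>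

text \<open>Extensionality is included so that two such operators are equal once they agree on
  \<open>ell2 S\<close>. The constant bounds the square of the operator norm, and no sign is imposed
  on it.\<close>

definition bounded_on :: "'i set \<Rightarrow> 'i oper \<Rightarrow> bool" where
  "bounded_on S A \<longleftrightarrow>
     A \<in> extensional (ell2 S) \<and> linear_on_ell2 S A \<and> A ` ell2 S \<subseteq> ell2 S \<and>
     (\<exists>c. \<forall>\<psi>\<in>ell2 S. sqnorm S (A \<psi>) \<le> c * sqnorm S \<psi>)"

lemma bounded_on_extensional: "bounded_on S A \<Longrightarrow> A \<in> extensional (ell2 S)"
  by (simp add: bounded_on_def)

lemma bounded_on_ell2: "bounded_on S A \<Longrightarrow> \<psi> \<in> ell2 S \<Longrightarrow> A \<psi> \<in> ell2 S"
  by (auto simp: bounded_on_def)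

lemma bounded_on_add:
  "bounded_on S A \<Longrightarrow> \<phi> \<in> ell2 S \<Longrightarrow> \<psi> \<in> ell2 S \<Longrightarrow> A (\<lambda>s. \<phi> s + \<psi> s) = (\<lambda>s. A \<phi> s + A \<psi> s)"
  by (simp add: bounded_on_def linear_on_ell2_def)

lemma bounded_on_scale:
  "bounded_on S A \<Longrightarrow> \<psi> \<in> ell2 S \<Longrightarrow> A (\<lambda>s. c * \<psi> s) = (\<lambda>s. c * A \<psi> s)"
  by (simp add: bounded_on_def linear_on_ell2_def)

lemma bounded_onI:
  assumes "A \<in> extensional (ell2 S)"
    and "\<And>\<phi> \<psi>. \<phi> \<in> ell2 S \<Longrightarrow> \<psi> \<in> ell2 S \<Longrightarrow> A (\<lambda>s. \<phi> s + \<psi> s) = (\<lambda>s. A \<phi> s + A \<psi> s)"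
    and "\<And>c \<psi>. \<psi> \<in> ell2 S \<Longrightarrow> A (\<lambda>s. c * \<psi> s) = (\<lambda>s. c * A \<psi> s)"
    and "\<And>\<psi>. \<psi> \<in> ell2 S \<Longrightarrow> A \<psi> \<in> ell2 S"
    and "\<And>\<psi>. \<psi> \<in> ell2 S \<Longrightarrow> sqnorm S (A \<psi>) \<le> c * sqnorm S \<psi>"
  shows "bounded_on S A"
  unfolding bounded_on_def linear_on_ell2_def using assms by blast

text \<open>If every vector has norm 0, a negative constant satisfies the definition. Passing to
  \<open>max 0 c\<close> gives the sign needed to multiply inequalities, as in
  \<open>bounded_on_compose\<close>.\<close>

lemma bounded_on_bound:
  assumes "bounded_on S A"
  obtains c where "c \<ge> 0" "\<And>\<psi>. \<psi> \<in> ell2 S \<Longrightarrow> sqnorm S (A \<psi>) \<le> c * sqnorm S \<psi>"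
proof -
  obtain c where c: "\<And>\<psi>. \<psi> \<in> ell2 S \<Longrightarrow> sqnorm S (A \<psi>) \<le> c * sqnorm S \<psi>"
    using assms by (auto simp: bounded_on_def)
  have "sqnorm S (A \<psi>) \<le> max 0 c * sqnorm S \<psi>" if "\<psi> \<in> ell2 S" for \<psi>
    using c[OF that] mult_right_mono[OF max.cobounded2[of c 0] sqnorm_nonneg[of S \<psi>]] by linarith
  then show ?thesis
    using that[of "max 0 c"] by simp
qed

lemma bounded_on_id: "bounded_on S (id_op S)"
  by (rule bounded_onI[where c = 1]) (auto simp: id_op_def ell2_add ell2_scale)

lemma bounded_on_compose:
  assumes A: "bounded_on S A" and B: "bounded_on S B"
  shows "bounded_on S (compose (ell2 S) A B)"
proof -
  obtain a where a: "a \<ge> 0" "\<And>\<psi>. \<psi> \<in> ell2 S \<Longrightarrow> sqnorm S (A \<psi>) \<le> a * sqnorm S \<psi>"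
    using bounded_on_bound[OF A] by metis
  obtain b where b: "\<And>\<psi>. \<psi> \<in> ell2 S \<Longrightarrow> sqnorm S (B \<psi>) \<le> b * sqnorm S \<psi>"
    using bounded_on_bound[OF B] by metis
  show ?thesis
  proof (rule bounded_onI[where c = "a * b"])
    fix \<psi> assume \<psi>: "\<psi> \<in> ell2 S"
    have "sqnorm S (A (B \<psi>)) \<le> a * (b * sqnorm S \<psi>)"
      using a(2)[OF bounded_on_ell2[OF B \<psi>]] mult_left_mono[OF b[OF \<psi>] a(1)] by linarith
    then show "sqnorm S (compose (ell2 S) A B \<psi>) \<le> a * b * sqnorm S \<psi>"
      using \<psi> by (simp add: compose_def mult.assoc)
  qed (use A B in \<open>auto simp: compose_def ell2_add ell2_scale bounded_on_ell2 bounded_on_add bounded_on_scale\<close>)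
qed

lemma bounded_on_sum_list:
  assumes "\<And>A. A \<in> set As \<Longrightarrow> bounded_on S A"
  shows "bounded_on S (\<lambda>\<psi>\<in>ell2 S. \<lambda>s. \<Sum>A\<leftarrow>As. A \<psi> s)"
  using assms
proof (induction As)
  case Nil
  show ?case
    by (rule bounded_onI[where c = 0]) (auto simp: ell2_zero ell2_add ell2_scale sqnorm_def extensional_def)
next
  case (Cons A As)
  let ?B = "\<lambda>\<psi>\<in>ell2 S. \<lambda>s. \<Sum>A\<leftarrow>As. A \<psi> s"
  have A: "bounded_on S A" and B: "bounded_on S ?B"
    using Cons.prems by (auto intro: Cons.IH)
  obtain a where a: "\<And>\<psi>. \<psi> \<in> ell2 S \<Longrightarrow> sqnorm S (A \<psi>) \<le> a * sqnorm S \<psi>"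
    using bounded_on_bound[OF A] by metis
  obtain b where b: "\<And>\<psi>. \<psi> \<in> ell2 S \<Longrightarrow> sqnorm S (?B \<psi>) \<le> b * sqnorm S \<psi>"
    using bounded_on_bound[OF B] by metis
  have eq: "(\<lambda>\<psi>\<in>ell2 S. \<lambda>s. \<Sum>A\<leftarrow>A # As. A \<psi> s) = (\<lambda>\<psi>\<in>ell2 S. \<lambda>s. A \<psi> s + ?B \<psi> s)"
    by (auto simp: fun_eq_iff)
  show ?case
    unfolding eq
  proof (rule bounded_onI[where c = "2 * a + 2 * b"])
    fix \<psi> assume \<psi>: "\<psi> \<in> ell2 S"
    have "sqnorm S (\<lambda>s. A \<psi> s + ?B \<psi> s) \<le> 2 * sqnorm S (A \<psi>) + 2 * sqnorm S (?B \<psi>)"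
      by (intro sqnorm_add bounded_on_ell2[OF A] bounded_on_ell2[OF B] \<psi>)
    also have "\<dots> \<le> (2 * a + 2 * b) * sqnorm S \<psi>"
      using a[OF \<psi>] b[OF \<psi>] by (simp add: distrib_right)
    finally show "sqnorm S ((\<lambda>\<psi>\<in>ell2 S. \<lambda>s. A \<psi> s + ?B \<psi> s) \<psi>) \<le> (2 * a + 2 * b) * sqnorm S \<psi>"
      using \<psi> by simp
    show "(\<lambda>\<psi>\<in>ell2 S. \<lambda>s. A \<psi> s + ?B \<psi> s) \<psi> \<in> ell2 S"
      using ell2_add[OF bounded_on_ell2[OF A \<psi>] bounded_on_ell2[OF B \<psi>]] \<psi> by simp
  next
    fix \<phi> \<psi> assume "\<phi> \<in> ell2 S" "\<psi> \<in> ell2 S"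
    then show "(\<lambda>\<psi>\<in>ell2 S. \<lambda>s. A \<psi> s + ?B \<psi> s) (\<lambda>s. \<phi> s + \<psi> s) =
        (\<lambda>s. (\<lambda>\<psi>\<in>ell2 S. \<lambda>s. A \<psi> s + ?B \<psi> s) \<phi> s + (\<lambda>\<psi>\<in>ell2 S. \<lambda>s. A \<psi> s + ?B \<psi> s) \<psi> s)"
      using bounded_on_add[OF A, of \<phi> \<psi>] bounded_on_add[OF B, of \<phi> \<psi>]
      by (simp add: ell2_add fun_eq_iff)
  next
    fix c \<psi> assume "\<psi> \<in> ell2 S"
    then show "(\<lambda>\<psi>\<in>ell2 S. \<lambda>s. A \<psi> s + ?B \<psi> s) (\<lambda>s. c * \<psi> s) =
        (\<lambda>s. c * (\<lambda>\<psi>\<in>ell2 S. \<lambda>s. A \<psi> s + ?B \<psi> s) \<psi> s)"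
      using bounded_on_scale[OF A, of \<psi> c] bounded_on_scale[OF B, of \<psi> c]
      by (simp add: ell2_scale fun_eq_iff distrib_left)
  qed (rule restrict_extensional)
qed

lemma bounded_on_unitary:
  assumes "unitary_on S U"
  shows "bounded_on S U"
proof -
  have "sqnorm S (U \<psi>) = sqnorm S \<psi>" if "\<psi> \<in> ell2 S" for \<psi>
  proof -
    have "inner_prod S (U \<psi>) (U \<psi>) = inner_prod S \<psi> \<psi>"
      using assms that by (simp add: unitary_on_def)
    then show ?thesis
      by (simp add: inner_prod_self)
  qed
  then show ?thesis
    using assms by (auto simp: bounded_on_def unitary_on_def intro!: exI[of _ 1])
qed

text \<open>Cauchy-Schwarz bounds the coefficient of the image, which contributes one factor
  \<open>sqnorm S \<phi>\<close>; the vector \<open>\<phi>\<close> that it multiplies contributes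
  the other.\<close>

lemma bounded_on_proj:
  assumes \<phi>: "\<phi> \<in> ell2 S"
  shows "bounded_on S (proj_op S \<phi>)"
proof (rule bounded_onI[where c = "sqnorm S \<phi> * sqnorm S \<phi>"])
  fix \<psi> assume \<psi>: "\<psi> \<in> ell2 S"
  show "proj_op S \<phi> \<psi> \<in> ell2 S"
    using \<phi> \<psi> by (simp add: proj_op_def ell2_scale)
  have "sqnorm S (proj_op S \<phi> \<psi>) = (cmod (inner_prod S \<phi> \<psi>))\<^sup>2 * sqnorm S \<phi>"
    using \<psi> by (simp add: proj_op_def sqnorm_scale)
  also have "\<dots> \<le> (sqnorm S \<phi> * sqnorm S \<psi>) * sqnorm S \<phi>"
    by (rule mult_right_mono[OF inner_prod_Cauchy_Schwarz[OF \<phi> \<psi>] sqnorm_nonneg])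
  finally show "sqnorm S (proj_op S \<phi> \<psi>) \<le> sqnorm S \<phi> * sqnorm S \<phi> * sqnorm S \<psi>"
    by (simp add: mult_ac)
qed (use \<phi> in \<open>auto simp: proj_op_def ell2_add ell2_scale inner_prod_add inner_prod_scale distrib_right mult.assoc\<close>)

text \<open>The Riesz representation: the kernel at \<open>u\<close> is the conjugate of \<open>f\<close> on the basis vector at \<open>u\<close>.\<close>

lemma bounded_functional_inner_prod:
  assumes add: "\<And>\<phi> \<psi>. \<phi> \<in> ell2 S \<Longrightarrow> \<psi> \<in> ell2 S \<Longrightarrow> f (\<lambda>s. \<phi> s + \<psi> s) = f \<phi> + f \<psi>"
    and scale: "\<And>c \<psi>. \<psi> \<in> ell2 S \<Longrightarrow> f (\<lambda>s. c * \<psi> s) = c * f \<psi>"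
    and bound: "\<And>\<psi>. \<psi> \<in> ell2 S \<Longrightarrow> (cmod (f \<psi>))\<^sup>2 \<le> c * sqnorm S \<psi>"
  obtains k where "k \<in> ell2 S" "\<And>\<psi>. \<psi> \<in> ell2 S \<Longrightarrow> f \<psi> = inner_prod S k \<psi>"
proof -
  define e :: "'a \<Rightarrow> 'a vec" where "e u = (\<lambda>t. if t = u then 1 else 0)" for u
  define k where "k = zero_ext S (\<lambda>u. cnj (f (e u)))"
  have f0: "f (\<lambda>s. 0) = 0"
    using scale[OF ell2_zero, of 0] by simp
  \<comment> \<open>On finitely supported vectors linearity alone determines
    \<open>f\<close>.\<close>
  have fin: "finite F \<Longrightarrow> F \<subseteq> S \<Longrightarrow> zero_ext F g \<in> ell2 S \<and> f (zero_ext F g) = (\<Sum>u\<in>F. g u * f (e u))"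
    for F g
  proof (induction F rule: finite_induct)
    case empty
    then show ?case by (simp add: zero_ext_def f0 ell2_zero)
  next
    case (insert u F)
    have e: "e u \<in> ell2 S"
      using insert.prems by (simp add: e_def ell2_unit)
    have IH: "zero_ext F g \<in> ell2 S" "f (zero_ext F g) = (\<Sum>u\<in>F. g u * f (e u))"
      using insert by auto
    have eq: "zero_ext (insert u F) g = (\<lambda>s. g u * e u s + zero_ext F g s)"
      using insert.hyps by (auto simp: zero_ext_def e_def)
    show ?case
      unfolding eq using add[OF ell2_scale[OF e, of "g u"] IH(1)] scale[OF e, of "g u"] IH insert.hyps
      by (simp add: ell2_add[OF ell2_scale[OF e]])
  qed
  have sqn_fin: "sqnorm S (zero_ext F g) = (\<Sum>u\<in>F. (cmod (g u))\<^sup>2)" if "finite F" "F \<subseteq> S" for F g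
  proof -
    have "sqnorm S (zero_ext F g) = (\<Sum>\<^sub>\<infinity>u\<in>F. (cmod (g u))\<^sup>2)"
      unfolding sqnorm_def by (rule infsum_cong_neutral) (use that in \<open>auto simp: zero_ext_def\<close>)
    then show ?thesis
      using that by simp
  qed
  \<comment> \<open>The bound on \<open>f\<close> is tested on the candidate kernel cut down to
    \<open>F\<close>. If \<open>N\<close> is the sum on the left, \<open>f\<close> takes the value
    \<open>N\<close> on a vector of squared norm \<open>N\<close>, so
    \<open>N\<^sup>2 \<le> c * N\<close>; thus all partial sums are uniformly bounded.\<close>
  have c: "(\<Sum>u\<in>F. (cmod (f (e u)))\<^sup>2) \<le> \<bar>c\<bar>" if F: "finite F" "F \<subseteq> S" for F
  proof -
    let ?N = "\<Sum>u\<in>F. (cmod (f (e u)))\<^sup>2"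
    let ?g = "\<lambda>u. cnj (f (e u))"
    have "f (zero_ext F ?g) = (\<Sum>u\<in>F. ?g u * f (e u))"
      using fin[OF F] by blast
    also have "\<dots> = of_real ?N"
      by (simp add: complex_norm_square mult.commute del: of_real_power)
    finally have "?N\<^sup>2 \<le> c * ?N"
      using bound[OF conjunct1[OF fin[OF F, of ?g]]] sqn_fin[OF F, of ?g]
      by (simp add: sum_nonneg del: of_real_sum)
    then have "?N * ?N \<le> \<bar>c\<bar> * ?N"
      using mult_right_mono[OF abs_ge_self[of c], of ?N] by (simp add: power2_eq_square sum_nonneg)
    then show ?thesis
      by (cases "?N = 0") (auto simp: sum_nonneg less_le)
  qed
  have k: "k \<in> ell2 S"
    unfolding k_def zero_ext_in_ell2_iff
    by (rule nonneg_bdd_above_summable_on) (auto simp: bdd_above_def intro!: exI[of _ "\<bar>c\<bar>"] c)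
  moreover have "f \<psi> = inner_prod S k \<psi>" if \<psi>: "\<psi> \<in> ell2 S" for \<psi>
  proof -
    let ?G = "finite_subsets_at_top S"
    have tail: "sqnorm S (\<lambda>s. \<psi> s - zero_ext F \<psi> s) = sqnorm S \<psi> - (\<Sum>s\<in>F. (cmod (\<psi> s))\<^sup>2)"
      and tail_in: "(\<lambda>s. \<psi> s - zero_ext F \<psi> s) \<in> ell2 S"
      if F: "finite F" "F \<subseteq> S" for F
    proof -
      have eq: "(\<lambda>s. \<psi> s - zero_ext F \<psi> s) = zero_ext (S - F) \<psi>"
        using ell2_outside[OF \<psi>] by (auto simp: zero_ext_def)
      show "(\<lambda>s. \<psi> s - zero_ext F \<psi> s) \<in> ell2 S"
        unfolding eq by (rule ell2_truncate[OF \<psi>]) auto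
      have "sqnorm S (zero_ext (S - F) \<psi>) = (\<Sum>\<^sub>\<infinity>s\<in>S - F. (cmod (\<psi> s))\<^sup>2)"
        unfolding sqnorm_def by (rule infsum_cong_neutral) (auto simp: zero_ext_def)
      also have "\<dots> = sqnorm S \<psi> - (\<Sum>s\<in>F. (cmod (\<psi> s))\<^sup>2)"
        unfolding sqnorm_def using F by (subst infsum_Diff) (auto intro: ell2_summable[OF \<psi>])
      finally show "sqnorm S (\<lambda>s. \<psi> s - zero_ext F \<psi> s) = sqnorm S \<psi> - (\<Sum>s\<in>F. (cmod (\<psi> s))\<^sup>2)"
        by (simp add: eq)
    qed
    have "((\<lambda>F. \<Sum>s\<in>F. (cmod (\<psi> s))\<^sup>2) \<longlongrightarrow> sqnorm S \<psi>) ?G"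
      unfolding sqnorm_def by (rule infsum_tendsto[OF ell2_summable[OF \<psi>]])
    then have "((\<lambda>F. c * (sqnorm S \<psi> - (\<Sum>s\<in>F. (cmod (\<psi> s))\<^sup>2))) \<longlongrightarrow> c * (sqnorm S \<psi> - sqnorm S \<psi>)) ?G"
      by (intro tendsto_intros)
    then have lim0: "((\<lambda>F. c * (sqnorm S \<psi> - (\<Sum>s\<in>F. (cmod (\<psi> s))\<^sup>2))) \<longlongrightarrow> 0) ?G"
      by simp
    \<comment> \<open>Truncating to \<open>F\<close> changes \<open>f \<psi>\<close> by
      \<open>f\<close> of the tail, whose squared norm is what \<open>F\<close> misses of
      \<open>sqnorm S \<psi>\<close>. Here boundedness extends the formula from finitely supported
      vectors to all vectors.\<close>
    have ev: "eventually (\<lambda>F. (cmod (f \<psi> - (\<Sum>u\<in>F. cnj (k u) * \<psi> u)))\<^sup>2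
        \<le> c * (sqnorm S \<psi> - (\<Sum>s\<in>F. (cmod (\<psi> s))\<^sup>2))) ?G"
      unfolding eventually_finite_subsets_at_top
    proof (intro exI[of _ "{}"] conjI allI impI)
      fix F assume "finite F \<and> {} \<subseteq> F \<and> F \<subseteq> S"
      then have F: "finite F" "F \<subseteq> S" by auto
      have "f (\<lambda>s. (\<psi> s - zero_ext F \<psi> s) + zero_ext F \<psi> s) =
          f (\<lambda>s. \<psi> s - zero_ext F \<psi> s) + f (zero_ext F \<psi>)"
        by (rule add[OF tail_in[OF F] ell2_truncate[OF \<psi> F(2)]])
      moreover have "f (zero_ext F \<psi>) = (\<Sum>u\<in>F. cnj (k u) * \<psi> u)"
        using conjunct2[OF fin[OF F, of \<psi>]] F(2)
        by (auto simp: k_def zero_ext_def mult.commute intro!: sum.cong)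
      ultimately have "f \<psi> - (\<Sum>u\<in>F. cnj (k u) * \<psi> u) = f (\<lambda>s. \<psi> s - zero_ext F \<psi> s)"
        by simp
      then show "(cmod (f \<psi> - (\<Sum>u\<in>F. cnj (k u) * \<psi> u)))\<^sup>2 \<le> c * (sqnorm S \<psi> - (\<Sum>s\<in>F. (cmod (\<psi> s))\<^sup>2))"
        using bound[OF tail_in[OF F]] tail[OF F] by simp
    qed auto
    have "((\<lambda>F. (cmod (f \<psi> - (\<Sum>u\<in>F. cnj (k u) * \<psi> u)))\<^sup>2) \<longlongrightarrow> 0) ?G"
      by (rule tendsto_sandwich[OF _ ev tendsto_const lim0]) auto
    moreover have "((\<lambda>F. (cmod (f \<psi> - (\<Sum>u\<in>F. cnj (k u) * \<psi> u)))\<^sup>2)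
        \<longlongrightarrow> (cmod (f \<psi> - inner_prod S k \<psi>))\<^sup>2) ?G"
      unfolding inner_prod_def
      by (intro tendsto_intros infsum_tendsto inner_prod_summable k \<psi>)
    ultimately have "(cmod (f \<psi> - inner_prod S k \<psi>))\<^sup>2 = 0"
      using tendsto_unique[OF finite_subsets_at_top_neq_bot] by blast
    then show ?thesis by simp
  qed
  ultimately show ?thesis
    using that by blast
qed

lemma cmod_power2_le_sqnorm:
  assumes "\<psi> \<in> ell2 S"
  shows "(cmod (\<psi> s))\<^sup>2 \<le> sqnorm S \<psi>"
proof (cases "s \<in> S")
  case True
  then have "sum (\<lambda>s. (cmod (\<psi> s))\<^sup>2) {s} \<le> sqnorm S \<psi>"
    unfolding sqnorm_def by (intro finite_sum_le_infsum ell2_summable[OF assms]) auto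
  then show ?thesis by simp
qed (simp add: ell2_outside[OF assms] sqnorm_nonneg)

text \<open>One coordinate is dominated by the norm, so evaluating \<open>A \<psi>\<close> at
  \<open>s\<close> is a bounded functional. For \<open>s\<close> in \<open>S\<close>, the kernel is
  the conjugate of the row of the matrix of \<open>A\<close> at \<open>s\<close>.\<close>

lemma bounded_on_kernel:
  assumes A: "bounded_on S A"
  obtains k where "k \<in> ell2 S" "\<And>\<psi>. \<psi> \<in> ell2 S \<Longrightarrow> A \<psi> s = inner_prod S k \<psi>"
proof -
  obtain c where c: "\<And>\<psi>. \<psi> \<in> ell2 S \<Longrightarrow> sqnorm S (A \<psi>) \<le> c * sqnorm S \<psi>"
    using bounded_on_bound[OF A] by metis
  show ?thesis
  proof (rule bounded_functional_inner_prod[of S "\<lambda>\<psi>. A \<psi> s" c])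
    fix \<psi> assume \<psi>: "\<psi> \<in> ell2 S"
    show "(cmod (A \<psi> s))\<^sup>2 \<le> c * sqnorm S \<psi>"
      using cmod_power2_le_sqnorm[OF bounded_on_ell2[OF A \<psi>], of s] c[OF \<psi>] by linarith
  qed (use A that in \<open>auto simp: bounded_on_add bounded_on_scale\<close>)
qed


section \<open>Operators acting on some of the variables\<close>

text \<open>The values of \<open>\<sigma>\<close> on \<open>V\<close> do not matter. A slice can
  thus be indexed by an assignment on \<open>T - V\<close>, for summing over all slices, or by the
  full assignment on \<open>T\<close> at which a result is evaluated; hence the disjunctive premises
  below.\<close>

definition slice :: "('v \<Rightarrow> 'x set) \<Rightarrow> 'v set \<Rightarrow> ('v \<Rightarrow> 'x) vec \<Rightarrow> ('v \<Rightarrow> 'x) \<Rightarrow> ('v \<Rightarrow> 'x) vec" where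
  "slice X V \<psi> \<sigma> = zero_ext (assigns X V) (\<lambda>\<rho>. \<psi> (override_on \<sigma> \<rho> V))"

text \<open>For \<open>V \<subseteq> T\<close> this is \<open>A\<close> tensored with the identity
  on \<open>T - V\<close>. In contrast to \<open>extend\<close> it involves no pairs and no
  relabelling, so nested extensions reduce to equations between assignments.\<close>

definition lift :: "('v \<Rightarrow> 'x set) \<Rightarrow> 'v set \<Rightarrow> 'v set \<Rightarrow> ('v \<Rightarrow> 'x) oper \<Rightarrow> ('v \<Rightarrow> 'x) oper" where
  "lift X V T A = (\<lambda>\<psi>\<in>ell2 (assigns X T). zero_ext (assigns X T)
     (\<lambda>\<sigma>. A (slice X V \<psi> \<sigma>) (restrict \<sigma> V)))"

lemma override_on_PiE:
  "\<sigma> \<in> PiE (T - V) X \<or> \<sigma> \<in> PiE T X \<Longrightarrow> \<rho> \<in> PiE V X \<Longrightarrow> V \<subseteq> T \<Longrightarrow> override_on \<sigma> \<rho> V \<in> PiE T X"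
  by (auto simp: override_on_def PiE_iff extensional_def)

lemma override_on_override_on [simp]: "override_on (override_on \<sigma> \<rho> V) \<rho>' V = override_on \<sigma> \<rho>' V"
  by (auto simp: override_on_def)

lemma restrict_override_on:
  "\<rho> \<in> PiE V X \<Longrightarrow> restrict (override_on \<sigma> \<rho> V) V = \<rho>"
  by (auto simp: override_on_def PiE_iff extensional_def restrict_def fun_eq_iff)

lemma restrict_override_on_disjoint:
  "V \<inter> W = {} \<Longrightarrow> restrict (override_on \<sigma> \<rho> V) W = restrict \<sigma> W"
  by (auto simp: override_on_def restrict_def fun_eq_iff)

lemma restrict_PiE_subset: "\<sigma> \<in> PiE T X \<Longrightarrow> V \<subseteq> T \<Longrightarrow> restrict \<sigma> V \<in> PiE V X"
  by (auto simp: PiE_iff)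

lemma inj_on_override_on: "inj_on (\<lambda>\<rho>. override_on \<sigma> \<rho> V) (PiE V X)"
  by (rule inj_on_inverseI[of _ "\<lambda>\<sigma>. restrict \<sigma> V"]) (rule restrict_override_on)

lemma slice_ell2:
  assumes "\<psi> \<in> ell2 (assigns X T)" "V \<subseteq> T" "\<sigma> \<in> PiE (T - V) X \<or> \<sigma> \<in> PiE T X"
  shows "slice X V \<psi> \<sigma> \<in> ell2 (assigns X V)"
  unfolding slice_def
  by (rule ell2_subset_comp[OF assms(1) inj_on_override_on])
    (rule image_subsetI, rule override_on_PiE[OF assms(3) _ assms(2)])

lemma slice_override_on [simp]: "slice X V \<psi> (override_on \<sigma> \<rho> V) = slice X V \<psi> \<sigma>"
  by (simp add: slice_def)

lemma slice_apply: "\<rho> \<in> PiE V X \<Longrightarrow> slice X V \<psi> \<sigma> \<rho> = \<psi> (override_on \<sigma> \<rho> V)"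
  by (simp add: slice_def zero_ext_def)

lemma lift_apply:
  "\<psi> \<in> ell2 (assigns X T) \<Longrightarrow> \<sigma> \<in> assigns X T \<Longrightarrow>
    lift X V T A \<psi> \<sigma> = A (slice X V \<psi> \<sigma>) (restrict \<sigma> V)"
  by (simp add: lift_def zero_ext_def)

lemma lift_outside:
  "\<psi> \<in> ell2 (assigns X T) \<Longrightarrow> \<sigma> \<notin> assigns X T \<Longrightarrow> lift X V T A \<psi> \<sigma> = 0"
  by (simp add: lift_def zero_ext_def)

lemma lift_extensional: "lift X V T A \<in> extensional (ell2 (assigns X T))"
  by (simp add: lift_def)

lemma lift_eqI:
  assumes "B \<in> extensional (ell2 (assigns X T))"
    and "\<And>\<psi> \<sigma>. \<psi> \<in> ell2 (assigns X T) \<Longrightarrow> \<sigma> \<notin> assigns X T \<Longrightarrow> B \<psi> \<sigma> = 0"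
    and "\<And>\<psi> \<sigma>. \<psi> \<in> ell2 (assigns X T) \<Longrightarrow> \<sigma> \<in> assigns X T \<Longrightarrow>
      A (slice X V \<psi> \<sigma>) (restrict \<sigma> V) = B \<psi> \<sigma>"
  shows "lift X V T A = B"
proof (rule extensionalityI[OF lift_extensional assms(1)])
  fix \<psi> assume "\<psi> \<in> ell2 (assigns X T)"
  then show "lift X V T A \<psi> = B \<psi>"
    using assms(2,3) by (auto simp: lift_def zero_ext_def fun_eq_iff)
qed

text \<open>Reindexing along this bijection turns a sum over assignments on \<open>T\<close> into a
  sum over slices of sums within a slice.\<close>

lemma bij_betw_override_on:
  assumes "V \<subseteq> T"
  shows "bij_betw (\<lambda>(\<tau>, \<rho>). override_on \<tau> \<rho> V) (PiE (T - V) X \<times> PiE V X) (PiE T X)"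
proof (rule bij_betwI[where g = "\<lambda>\<sigma>. (restrict \<sigma> (T - V), restrict \<sigma> V)"])
  show "(\<lambda>(\<tau>, \<rho>). override_on \<tau> \<rho> V) \<in> PiE (T - V) X \<times> PiE V X \<rightarrow> PiE T X"
    using override_on_PiE[OF _ _ assms, where X = X] by (simp add: Pi_iff case_prod_unfold)
qed (use assms in \<open>auto simp: override_on_def PiE_iff extensional_def restrict_def fun_eq_iff\<close>)

lemma
  fixes f :: "'i \<Rightarrow> 'j \<Rightarrow> real" and g :: "'i \<Rightarrow> 'j \<Rightarrow> real"
  assumes g: "(\<lambda>(x, y). g x y) summable_on A \<times> B"
    and nonneg: "\<And>x y. x \<in> A \<Longrightarrow> y \<in> B \<Longrightarrow> 0 \<le> f x y" "\<And>x y. x \<in> A \<Longrightarrow> y \<in> B \<Longrightarrow> 0 \<le> g x y"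
    and f: "\<And>x. x \<in> A \<Longrightarrow> f x summable_on B"
    and le: "\<And>x. x \<in> A \<Longrightarrow> (\<Sum>\<^sub>\<infinity>y\<in>B. f x y) \<le> c * (\<Sum>\<^sub>\<infinity>y\<in>B. g x y)"
  shows summable_on_slicewise_le: "(\<lambda>(x, y). f x y) summable_on A \<times> B"
    and infsum_slicewise_le: "(\<Sum>\<^sub>\<infinity>(x, y)\<in>A \<times> B. f x y) \<le> c * (\<Sum>\<^sub>\<infinity>(x, y)\<in>A \<times> B. g x y)"
proof -
  have g1: "(\<lambda>x. \<Sum>\<^sub>\<infinity>y\<in>B. g x y) summable_on A"
    by (rule summable_on_Sigma_banach[OF g])
  have f1: "(\<lambda>x. \<Sum>\<^sub>\<infinity>y\<in>B. f x y) summable_on A"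
    by (rule summable_on_comparison_test[OF summable_on_cmult_right[OF g1, of c]])
      (auto simp: nonneg infsum_nonneg le)
  have "(\<lambda>(x, y). f x y) abs_summable_on A \<times> B"
    unfolding abs_summable_on_Sigma_iff
  proof (intro conjI ballI)
    fix x assume x: "x \<in> A"
    show "(\<lambda>y. case (x, y) of (x, y) \<Rightarrow> f x y) abs_summable_on B"
      using f[OF x] nonneg(1)[OF x] by (auto cong: summable_on_cong)
  next
    have "(\<lambda>x. norm (\<Sum>\<^sub>\<infinity>y\<in>B. norm (f x y))) summable_on A \<longleftrightarrow> (\<lambda>x. \<Sum>\<^sub>\<infinity>y\<in>B. f x y) summable_on A"
      by (rule summable_on_cong) (simp add: infsum_nonneg nonneg cong: infsum_cong)
    then show "(\<lambda>x. \<Sum>\<^sub>\<infinity>y\<in>B. norm (case (x, y) of (x, y) \<Rightarrow> f x y)) abs_summable_on A"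
      using f1 by simp
  qed
  then show fs: "(\<lambda>(x, y). f x y) summable_on A \<times> B"
    by (rule abs_summable_summable)
  have "(\<Sum>\<^sub>\<infinity>x\<in>A. \<Sum>\<^sub>\<infinity>y\<in>B. f x y) \<le> (\<Sum>\<^sub>\<infinity>x\<in>A. c * (\<Sum>\<^sub>\<infinity>y\<in>B. g x y))"
    by (rule infsum_mono[OF f1 summable_on_cmult_right[OF g1] le])
  then show "(\<Sum>\<^sub>\<infinity>(x, y)\<in>A \<times> B. f x y) \<le> c * (\<Sum>\<^sub>\<infinity>(x, y)\<in>A \<times> B. g x y)"
    by (simp add: infsum_Sigma'_banach[OF fs] infsum_Sigma'_banach[OF g] infsum_cmult_right')
qed

text \<open>Each slice grows by at most the factor \<open>c\<close>, and the squared norms of the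
  slices add up to that of the vector. The lifted operator therefore keeps the constant of
  \<open>A\<close>, and the same comparison shows that it maps into \<open>ell2\<close>.\<close>

lemma bounded_on_lift:
  assumes VT: "V \<subseteq> T" and A: "bounded_on (assigns X V) A"
  shows "bounded_on (assigns X T) (lift X V T A)"
proof -
  obtain c where c: "\<And>\<psi>. \<psi> \<in> ell2 (assigns X V) \<Longrightarrow>
      sqnorm (assigns X V) (A \<psi>) \<le> c * sqnorm (assigns X V) \<psi>"
    using bounded_on_bound[OF A] by metis
  note bij = bij_betw_override_on[OF VT, of X]
  have main: "lift X V T A \<psi> \<in> ell2 (assigns X T) \<and>
      sqnorm (assigns X T) (lift X V T A \<psi>) \<le> c * sqnorm (assigns X T) \<psi>"
    if \<psi>: "\<psi> \<in> ell2 (assigns X T)" for \<psi>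
  proof -
    let ?L = "lift X V T A \<psi>"
    let ?R = "assigns X (T - V)" and ?S = "assigns X V"
    let ?f = "\<lambda>\<tau> \<rho>. (cmod (?L (override_on \<tau> \<rho> V)))\<^sup>2"
    let ?g = "\<lambda>\<tau> \<rho>. (cmod (\<psi> (override_on \<tau> \<rho> V)))\<^sup>2"
    have sl: "slice X V \<psi> \<tau> \<in> ell2 ?S" if "\<tau> \<in> ?R" for \<tau>
      using that by (intro slice_ell2[OF \<psi> VT]) auto
    have L: "?L (override_on \<tau> \<rho> V) = A (slice X V \<psi> \<tau>) \<rho>" if "\<tau> \<in> ?R" "\<rho> \<in> ?S" for \<tau> \<rho>
      using that VT by (simp add: lift_apply[OF \<psi>] override_on_PiE restrict_override_on)
    have g: "(\<lambda>(\<tau>, \<rho>). ?g \<tau> \<rho>) summable_on ?R \<times> ?S"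
      using ell2_summable[OF \<psi>] summable_on_reindex_bij_betw[OF bij, of "\<lambda>\<sigma>. (cmod (\<psi> \<sigma>))\<^sup>2"]
      by (simp add: case_prod_unfold)
    have f: "?f \<tau> summable_on ?S" if "\<tau> \<in> ?R" for \<tau>
      using ell2_summable[OF bounded_on_ell2[OF A sl[OF that]]] by (simp add: L that cong: summable_on_cong)
    have le: "(\<Sum>\<^sub>\<infinity>\<rho>\<in>?S. ?f \<tau> \<rho>) \<le> c * (\<Sum>\<^sub>\<infinity>\<rho>\<in>?S. ?g \<tau> \<rho>)" if "\<tau> \<in> ?R" for \<tau>
      using c[OF sl[OF that]] by (simp add: L that sqnorm_def slice_apply cong: infsum_cong)
    have "(\<lambda>(\<tau>, \<rho>). ?f \<tau> \<rho>) summable_on ?R \<times> ?S"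
      by (rule summable_on_slicewise_le[OF g _ _ f le]) auto
    then have "(\<lambda>\<sigma>. (cmod (?L \<sigma>))\<^sup>2) summable_on assigns X T"
      using summable_on_reindex_bij_betw[OF bij, of "\<lambda>\<sigma>. (cmod (?L \<sigma>))\<^sup>2"]
      by (simp add: case_prod_unfold)
    moreover have "(\<Sum>\<^sub>\<infinity>(\<tau>, \<rho>)\<in>?R \<times> ?S. ?f \<tau> \<rho>) \<le> c * (\<Sum>\<^sub>\<infinity>(\<tau>, \<rho>)\<in>?R \<times> ?S. ?g \<tau> \<rho>)"
      by (rule infsum_slicewise_le[OF g _ _ f le]) auto
    ultimately show ?thesis
      using infsum_reindex_bij_betw[OF bij, of "\<lambda>\<sigma>. (cmod (?L \<sigma>))\<^sup>2"]
        infsum_reindex_bij_betw[OF bij, of "\<lambda>\<sigma>. (cmod (\<psi> \<sigma>))\<^sup>2"] \<psi>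
      by (auto simp: sqnorm_def ell2_def lift_outside case_prod_unfold)
  qed
  show ?thesis
  proof (rule bounded_onI[where c = c])
    fix \<phi> \<psi> assume \<phi>: "\<phi> \<in> ell2 (assigns X T)" and \<psi>: "\<psi> \<in> ell2 (assigns X T)"
    have "slice X V (\<lambda>s. \<phi> s + \<psi> s) \<sigma> = (\<lambda>\<rho>. slice X V \<phi> \<sigma> \<rho> + slice X V \<psi> \<sigma> \<rho>)" for \<sigma>
      by (auto simp: slice_def zero_ext_def)
    then show "lift X V T A (\<lambda>s. \<phi> s + \<psi> s) = (\<lambda>\<sigma>. lift X V T A \<phi> \<sigma> + lift X V T A \<psi> \<sigma>)"
      using slice_ell2[OF \<phi> VT] slice_ell2[OF \<psi> VT] \<phi> \<psi>
      by (auto simp: lift_def zero_ext_def ell2_add bounded_on_add[OF A])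
  next
    fix c \<psi> assume \<psi>: "\<psi> \<in> ell2 (assigns X T)"
    have "slice X V (\<lambda>s. c * \<psi> s) \<sigma> = (\<lambda>\<rho>. c * slice X V \<psi> \<sigma> \<rho>)" for \<sigma>
      by (auto simp: slice_def zero_ext_def)
    then show "lift X V T A (\<lambda>s. c * \<psi> s) = (\<lambda>\<sigma>. c * lift X V T A \<psi> \<sigma>)"
      using slice_ell2[OF \<psi> VT] \<psi> by (auto simp: lift_def zero_ext_def ell2_scale bounded_on_scale[OF A])
  qed (auto simp: main lift_extensional)
qed

lemma lift_id:
  assumes "V \<subseteq> T"
  shows "lift X V T (id_op (assigns X V)) = id_op (assigns X T)"
proof (rule lift_eqI)
  fix \<psi> \<sigma> assume \<psi>: "\<psi> \<in> ell2 (assigns X T)" and \<sigma>: "\<sigma> \<in> assigns X T"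
  have ov: "override_on \<sigma> (restrict \<sigma> V) V = \<sigma>"
    by (auto simp: override_on_def)
  have r: "restrict \<sigma> V \<in> assigns X V"
    by (rule restrict_PiE_subset[OF \<sigma> assms])
  then show "id_op (assigns X V) (slice X V \<psi> \<sigma>) (restrict \<sigma> V) = id_op (assigns X T) \<psi> \<sigma>"
    using \<psi> \<sigma> assms by (simp add: id_op_def slice_ell2 slice_apply[OF r] ov)
qed (auto simp: id_op_def ell2_outside)

text \<open>A slice of a slice is a slice: since \<open>V \<subseteq> U\<close>, changing the
  \<open>U\<close>-part of \<open>\<sigma>\<close> on \<open>V\<close> only is the same as changing
  \<open>\<sigma>\<close> on \<open>V\<close>. Chains of extensions in the semantics collapse by
  this.\<close>

lemma lift_lift:
  assumes "V \<subseteq> U" "U \<subseteq> T"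
  shows "lift X U T (lift X V U A) = lift X V T A"
proof (rule lift_eqI[OF lift_extensional lift_outside])
  fix \<psi> \<sigma> assume \<psi>: "\<psi> \<in> ell2 (assigns X T)" and \<sigma>: "\<sigma> \<in> assigns X T"
  have rU: "restrict \<sigma> U \<in> assigns X U"
    by (rule restrict_PiE_subset[OF \<sigma> assms(2)])
  have "slice X V (slice X U \<psi> \<sigma>) (restrict \<sigma> U) \<rho> = slice X V \<psi> \<sigma> \<rho>" for \<rho>
  proof (cases "\<rho> \<in> assigns X V")
    case True
    have "override_on \<sigma> (override_on (restrict \<sigma> U) \<rho> V) U = override_on \<sigma> \<rho> V"
      using assms(1) by (auto simp: override_on_def fun_eq_iff)
    then show ?thesis
      using True rU assms(1) by (simp add: slice_apply override_on_PiE)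
  qed (simp add: slice_def zero_ext_def)
  then have "slice X V (slice X U \<psi> \<sigma>) (restrict \<sigma> U) = slice X V \<psi> \<sigma>"
    by (rule ext)
  moreover have "restrict (restrict \<sigma> U) V = restrict \<sigma> V"
    using assms(1) by (simp add: Int_absorb1)
  ultimately show "lift X V U A (slice X U \<psi> \<sigma>) (restrict \<sigma> U) = lift X V T A \<psi> \<sigma>"
    using \<psi> \<sigma> rU assms(2) by (simp add: lift_apply slice_ell2)
qed

text \<open>Overriding \<open>\<sigma>\<close> on \<open>V\<close> leaves its input slice unchanged,
  so all points of the output slice come from one application of \<open>A\<close>. This is what
  makes \<open>lift\<close> respect composition.\<close>

lemma slice_lift:
  assumes \<psi>: "\<psi> \<in> ell2 (assigns X T)" and \<sigma>: "\<sigma> \<in> assigns X T" and VT: "V \<subseteq> T"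
    and A: "bounded_on (assigns X V) A"
  shows "slice X V (lift X V T A \<psi>) \<sigma> = A (slice X V \<psi> \<sigma>)"
proof
  fix \<rho>
  have sl: "slice X V \<psi> \<sigma> \<in> ell2 (assigns X V)"
    using \<sigma> by (intro slice_ell2[OF \<psi> VT]) auto
  show "slice X V (lift X V T A \<psi>) \<sigma> \<rho> = A (slice X V \<psi> \<sigma>) \<rho>"
  proof (cases "\<rho> \<in> assigns X V")
    case True
    then show ?thesis
      using \<sigma> VT by (simp add: slice_apply lift_apply[OF \<psi>] override_on_PiE restrict_override_on)
  next
    case False
    then show ?thesis
      using ell2_outside[OF bounded_on_ell2[OF A sl] False] by (simp add: slice_def zero_ext_def)
  qed
qed

lemma lift_compose:
  assumes VT: "V \<subseteq> T" and A: "bounded_on (assigns X V) A" and B: "bounded_on (assigns X V) B"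
  shows "lift X V T (compose (ell2 (assigns X V)) A B) =
    compose (ell2 (assigns X T)) (lift X V T A) (lift X V T B)"
proof (rule lift_eqI)
  fix \<psi> \<sigma> assume \<psi>: "\<psi> \<in> ell2 (assigns X T)" and \<sigma>: "\<sigma> \<in> assigns X T"
  have "slice X V \<psi> \<sigma> \<in> ell2 (assigns X V)"
    using \<sigma> by (intro slice_ell2[OF \<psi> VT]) auto
  then show "compose (ell2 (assigns X V)) A B (slice X V \<psi> \<sigma>) (restrict \<sigma> V) =
      compose (ell2 (assigns X T)) (lift X V T A) (lift X V T B) \<psi> \<sigma>"
    using \<psi> \<sigma> bounded_on_ell2[OF bounded_on_lift[OF VT B] \<psi>]
    by (simp add: compose_def lift_apply slice_lift[OF \<psi> \<sigma> VT B])
next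
  fix \<psi> \<sigma> assume \<psi>: "\<psi> \<in> ell2 (assigns X T)" and \<sigma>: "\<sigma> \<notin> assigns X T"
  then show "compose (ell2 (assigns X T)) (lift X V T A) (lift X V T B) \<psi> \<sigma> = 0"
    using bounded_on_ell2[OF bounded_on_lift[OF VT B] \<psi>] by (simp add: compose_def lift_outside)
qed simp

lemma lift_sum_list:
  assumes VT: "V \<subseteq> T"
  shows "lift X V T (\<lambda>\<psi>\<in>ell2 (assigns X V). \<lambda>\<sigma>. \<Sum>A\<leftarrow>As. A \<psi> \<sigma>) =
    (\<lambda>\<psi>\<in>ell2 (assigns X T). \<lambda>\<sigma>. \<Sum>A\<leftarrow>As. lift X V T A \<psi> \<sigma>)"
proof (rule lift_eqI)
  fix \<psi> \<sigma> assume \<psi>: "\<psi> \<in> ell2 (assigns X T)" and \<sigma>: "\<sigma> \<in> assigns X T"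
  have "slice X V \<psi> \<sigma> \<in> ell2 (assigns X V)"
    using \<sigma> by (intro slice_ell2[OF \<psi> VT]) auto
  then show "(\<lambda>\<psi>\<in>ell2 (assigns X V). \<lambda>\<sigma>. \<Sum>A\<leftarrow>As. A \<psi> \<sigma>) (slice X V \<psi> \<sigma>) (restrict \<sigma> V) =
      (\<lambda>\<psi>\<in>ell2 (assigns X T). \<lambda>\<sigma>. \<Sum>A\<leftarrow>As. lift X V T A \<psi> \<sigma>) \<psi> \<sigma>"
    using \<psi> \<sigma> by (simp add: lift_apply)
qed (auto simp: lift_outside)

text \<open>
  Both composites are the same double sum against the kernels of \<open>A\<close> and \<open>B\<close>; the sum converges
  absolutely because a product of square-summable families is square-summable.
\<close>

lemma lift_lift_commute:
  assumes V: "V \<subseteq> T" and W: "W \<subseteq> T" and disj: "V \<inter> W = {}"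
    and A: "bounded_on (assigns X V) A" and B: "bounded_on (assigns X W) B"
    and \<psi>: "\<psi> \<in> ell2 (assigns X T)"
  shows "lift X V T A (lift X W T B \<psi>) = lift X W T B (lift X V T A \<psi>)"
proof
  fix \<sigma>
  have LA: "lift X V T A \<psi> \<in> ell2 (assigns X T)" and LB: "lift X W T B \<psi> \<in> ell2 (assigns X T)"
    using bounded_on_ell2[OF bounded_on_lift[OF V A] \<psi>] bounded_on_ell2[OF bounded_on_lift[OF W B] \<psi>] .
  show "lift X V T A (lift X W T B \<psi>) \<sigma> = lift X W T B (lift X V T A \<psi>) \<sigma>"
  proof (cases "\<sigma> \<in> assigns X T")
    case \<sigma>: True
    let ?V = "assigns X V" and ?W = "assigns X W"
    obtain k where k: "k \<in> ell2 ?V" "\<And>\<psi>. \<psi> \<in> ell2 ?V \<Longrightarrow> A \<psi> (restrict \<sigma> V) = inner_prod ?V k \<psi>"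
      using bounded_on_kernel[OF A] by metis
    \<comment> \<open>One kernel \<open>l\<close> serves every term of the outer sum: overriding
      \<open>\<sigma>\<close> on \<open>V\<close> does not change its \<open>W\<close>-part, which
      is the point where \<open>B\<close> is evaluated.\<close>
    obtain l where l: "l \<in> ell2 ?W" "\<And>\<psi>. \<psi> \<in> ell2 ?W \<Longrightarrow> B \<psi> (restrict \<sigma> W) = inner_prod ?W l \<psi>"
      using bounded_on_kernel[OF B] by metis
    let ?h = "\<lambda>(\<rho>, \<rho>'). override_on (override_on \<sigma> \<rho> V) \<rho>' W"
    have swap: "override_on (override_on \<sigma> \<rho>' W) \<rho> V = override_on (override_on \<sigma> \<rho> V) \<rho>' W" for \<rho> \<rho>'
      using disj by (auto simp: override_on_def fun_eq_iff)
    have "lift X V T A (lift X W T B \<psi>) \<sigma> = inner_prod ?V k (slice X V (lift X W T B \<psi>) \<sigma>)"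
      using \<sigma> by (simp add: lift_apply[OF LB] k(2) slice_ell2[OF LB V])
    also have "\<dots> = (\<Sum>\<^sub>\<infinity>\<rho>\<in>?V. cnj (k \<rho>) * lift X W T B \<psi> (override_on \<sigma> \<rho> V))"
      by (simp add: inner_prod_def slice_apply cong: infsum_cong)
    also have "\<dots> = (\<Sum>\<^sub>\<infinity>\<rho>\<in>?V. \<Sum>\<^sub>\<infinity>\<rho>'\<in>?W. (cnj (k \<rho>) * cnj (l \<rho>')) * \<psi> (?h (\<rho>, \<rho>')))"
    proof (rule infsum_cong)
      fix \<rho> assume \<rho>: "\<rho> \<in> ?V"
      then have ov: "override_on \<sigma> \<rho> V \<in> assigns X T"
        using \<sigma> V by (intro override_on_PiE) auto
      have "lift X W T B \<psi> (override_on \<sigma> \<rho> V) = inner_prod ?W l (slice X W \<psi> (override_on \<sigma> \<rho> V))"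
        using ov by (simp add: lift_apply[OF \<psi>] restrict_override_on_disjoint[OF disj] l(2) slice_ell2[OF \<psi> W])
      also have "\<dots> = (\<Sum>\<^sub>\<infinity>\<rho>'\<in>?W. cnj (l \<rho>') * \<psi> (?h (\<rho>, \<rho>')))"
        by (simp add: inner_prod_def slice_apply cong: infsum_cong)
      finally show "cnj (k \<rho>) * lift X W T B \<psi> (override_on \<sigma> \<rho> V) =
          (\<Sum>\<^sub>\<infinity>\<rho>'\<in>?W. (cnj (k \<rho>) * cnj (l \<rho>')) * \<psi> (?h (\<rho>, \<rho>')))"
        by (simp add: infsum_cmult_right' mult.assoc)
    qed
    also have "\<dots> = (\<Sum>\<^sub>\<infinity>\<rho>'\<in>?W. \<Sum>\<^sub>\<infinity>\<rho>\<in>?V. (cnj (k \<rho>) * cnj (l \<rho>')) * \<psi> (?h (\<rho>, \<rho>')))"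
    proof (rule infsum_swap_banach)
      let ?x = "\<lambda>(\<rho>, \<rho>'). cnj (k \<rho>) * cnj (l \<rho>')"
      have "(\<lambda>(\<rho>, \<rho>'). (cmod (k \<rho>))\<^sup>2 * (cmod (l \<rho>'))\<^sup>2) abs_summable_on ?V \<times> ?W"
        unfolding abs_summable_on_Sigma_iff
        using ell2_summable[OF k(1)] ell2_summable[OF l(1)]
        by (auto simp: abs_mult infsum_nonneg infsum_cmult_right'
            intro!: summable_on_cmult_left summable_on_cmult_right)
      then have x: "(\<lambda>i. (cmod (?x i))\<^sup>2) summable_on ?V \<times> ?W"
        by (auto dest!: abs_summable_summable simp: norm_mult power_mult_distrib case_prod_unfold)
      \<comment> \<open>Distinct pairs give distinct points, so the squares of \<open>\<psi>\<close>
        over pairs form a subfamily of those over \<open>assigns X T\<close>.\<close>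
      have inj: "inj_on ?h (?V \<times> ?W)"
      proof (rule inj_on_inverseI[where g = "\<lambda>\<sigma>. (restrict \<sigma> V, restrict \<sigma> W)"])
        fix p assume "p \<in> ?V \<times> ?W"
        then obtain \<rho> \<rho>' where p: "p = (\<rho>, \<rho>')" "\<rho> \<in> ?V" "\<rho>' \<in> ?W" by auto
        have "restrict (?h p) V = \<rho>"
          using disj by (simp add: p(1) restrict_override_on_disjoint Int_commute restrict_override_on[OF p(2)])
        then show "(restrict (?h p) V, restrict (?h p) W) = p"
          by (simp add: p(1) restrict_override_on[OF p(3)])
      qed
      have "?h p \<in> assigns X T" if "p \<in> ?V \<times> ?W" for p
        using that override_on_PiE[OF disjI2[OF override_on_PiE[OF disjI2[OF \<sigma>] _ V]] _ W] by auto
      then have "?h ` (?V \<times> ?W) \<subseteq> assigns X T"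
        by (rule image_subsetI)
      then have "(\<lambda>\<sigma>. (cmod (\<psi> \<sigma>))\<^sup>2) summable_on ?h ` (?V \<times> ?W)"
        by (rule summable_on_subset[OF ell2_summable[OF \<psi>]])
      then have y: "(\<lambda>p. (cmod (\<psi> (?h p)))\<^sup>2) summable_on ?V \<times> ?W"
        using summable_on_reindex[OF inj, of "\<lambda>\<sigma>. (cmod (\<psi> \<sigma>))\<^sup>2"]
        by (simp add: o_def)
      have "(\<lambda>p. ?x p * \<psi> (?h p)) summable_on ?V \<times> ?W"
        by (rule abs_summable_summable[OF abs_summable_on_mult[OF x y]])
      then show "(\<lambda>(\<rho>, \<rho>'). (cnj (k \<rho>) * cnj (l \<rho>')) * \<psi> (?h (\<rho>, \<rho>'))) summable_on ?V \<times> ?W"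
        by (simp add: case_prod_unfold)
    qed
    also have "\<dots> = (\<Sum>\<^sub>\<infinity>\<rho>'\<in>?W. cnj (l \<rho>') * lift X V T A \<psi> (override_on \<sigma> \<rho>' W))"
    proof (rule infsum_cong)
      fix \<rho>' assume \<rho>': "\<rho>' \<in> ?W"
      then have ov: "override_on \<sigma> \<rho>' W \<in> assigns X T"
        using \<sigma> W by (intro override_on_PiE) auto
      have "restrict (override_on \<sigma> \<rho>' W) V = restrict \<sigma> V"
        using disj by (intro restrict_override_on_disjoint) auto
      then have "lift X V T A \<psi> (override_on \<sigma> \<rho>' W) = inner_prod ?V k (slice X V \<psi> (override_on \<sigma> \<rho>' W))"
        using ov by (simp add: lift_apply[OF \<psi>] k(2) slice_ell2[OF \<psi> V])
      also have "\<dots> = (\<Sum>\<^sub>\<infinity>\<rho>\<in>?V. cnj (k \<rho>) * \<psi> (?h (\<rho>, \<rho>')))"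
        by (simp add: inner_prod_def slice_apply swap cong: infsum_cong)
      finally show "(\<Sum>\<^sub>\<infinity>\<rho>\<in>?V. (cnj (k \<rho>) * cnj (l \<rho>')) * \<psi> (?h (\<rho>, \<rho>'))) =
          cnj (l \<rho>') * lift X V T A \<psi> (override_on \<sigma> \<rho>' W)"
        by (simp add: infsum_cmult_right' mult.assoc mult.left_commute[of "cnj (k _)"])
    qed
    also have "\<dots> = inner_prod ?W l (slice X W (lift X V T A \<psi>) \<sigma>)"
      by (simp add: inner_prod_def slice_apply cong: infsum_cong)
    also have "\<dots> = lift X W T B (lift X V T A \<psi>) \<sigma>"
      using \<sigma> by (simp add: lift_apply[OF LA] l(2) slice_ell2[OF LA W])
    finally show ?thesis .
  qed (simp add: lift_outside LA LB)
qed


section \<open>Change of basis indices\<close>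

text \<open>For injective \<open>f\<close> this is the unitary identification of the space over
  \<open>K\<close> with the space over the image of \<open>K\<close>; \<open>relabel K f A\<close>
  is \<open>A\<close> conjugated by it.\<close>

definition transport :: "'k set \<Rightarrow> ('k \<Rightarrow> 'i) \<Rightarrow> 'k vec \<Rightarrow> 'i vec" where
  "transport K f \<psi> = zero_ext (f ` K) (\<lambda>i. \<psi> (inv_into K f i))"

lemma transport_apply: "inj_on f K \<Longrightarrow> k \<in> K \<Longrightarrow> transport K f \<psi> (f k) = \<psi> k"
  by (simp add: transport_def zero_ext_def)

lemma transport_outside: "i \<notin> f ` K \<Longrightarrow> transport K f \<psi> i = 0"
  by (simp add: transport_def zero_ext_def)

text \<open>A transported vector is fixed by its values at the points \<open>f k\<close> and by
  vanishing elsewhere. Arguing this way keeps \<open>inv_into\<close> out of most later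
  proofs.\<close>

lemma transport_eqI:
  assumes "inj_on f K" "\<And>i. i \<notin> f ` K \<Longrightarrow> \<chi> i = 0" "\<And>k. k \<in> K \<Longrightarrow> \<chi> (f k) = \<psi> k"
  shows "transport K f \<psi> = \<chi>"
proof
  fix i
  show "transport K f \<psi> i = \<chi> i"
  proof (cases "i \<in> f ` K")
    case True
    then obtain k where "i = f k" "k \<in> K" by blast
    then show ?thesis
      using assms(1,3) by (simp add: transport_apply)
  qed (simp add: transport_outside assms(2))
qed

lemma transport_ell2: "\<psi> \<in> ell2 K \<Longrightarrow> transport K f \<psi> \<in> ell2 (f ` K)"
  unfolding transport_def
  by (rule ell2_subset_comp[OF _ inj_on_inv_into[OF order_refl]]) (auto intro: inv_into_into)

lemma transport_add: "transport K f (\<lambda>k. \<phi> k + \<psi> k) = (\<lambda>i. transport K f \<phi> i + transport K f \<psi> i)"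
  by (auto simp: transport_def zero_ext_def)

lemma transport_scale: "transport K f (\<lambda>k. c * \<psi> k) = (\<lambda>i. c * transport K f \<psi> i)"
  by (auto simp: transport_def zero_ext_def)

lemma sqnorm_transport:
  assumes "inj_on f K"
  shows "sqnorm (f ` K) (transport K f \<psi>) = sqnorm K \<psi>"
  unfolding sqnorm_def by (simp add: infsum_reindex[OF assms] o_def transport_apply[OF assms] cong: infsum_cong)

lemma relabel_apply:
  "\<psi> \<in> ell2 K \<Longrightarrow> k \<in> K \<Longrightarrow> relabel K f A \<psi> k = A (transport K f \<psi>) (f k)"
  by (simp add: relabel_def transport_def zero_ext_def[of K])

lemma relabel_outside: "\<psi> \<in> ell2 K \<Longrightarrow> k \<notin> K \<Longrightarrow> relabel K f A \<psi> k = 0"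
  by (simp add: relabel_def zero_ext_def[of K])

lemma relabel_extensional: "relabel K f A \<in> extensional (ell2 K)"
  by (simp add: relabel_def)

lemma relabel_eqI:
  assumes "B \<in> extensional (ell2 K)"
    and "\<And>\<psi> k. \<psi> \<in> ell2 K \<Longrightarrow> k \<notin> K \<Longrightarrow> B \<psi> k = 0"
    and "\<And>\<psi> k. \<psi> \<in> ell2 K \<Longrightarrow> k \<in> K \<Longrightarrow> A (transport K f \<psi>) (f k) = B \<psi> k"
  shows "relabel K f A = B"
proof (rule extensionalityI[OF relabel_extensional assms(1)])
  fix \<psi> assume \<psi>: "\<psi> \<in> ell2 K"
  show "relabel K f A \<psi> = B \<psi>"
  proof
    fix k
    show "relabel K f A \<psi> k = B \<psi> k"
      using \<psi> assms(2,3) by (cases "k \<in> K") (simp_all add: relabel_apply relabel_outside)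
  qed
qed

lemma transport_relabel:
  assumes f: "inj_on f K" and A: "bounded_on (f ` K) A" and \<psi>: "\<psi> \<in> ell2 K"
  shows "transport K f (relabel K f A \<psi>) = A (transport K f \<psi>)"
  by (rule transport_eqI[OF f])
    (simp_all add: relabel_apply[OF \<psi>] ell2_outside[OF bounded_on_ell2[OF A transport_ell2[OF \<psi>]]])

lemma bounded_on_relabel:
  assumes f: "inj_on f K" and A: "bounded_on (f ` K) A"
  shows "bounded_on K (relabel K f A)"
proof -
  obtain c where c: "\<And>\<psi>. \<psi> \<in> ell2 (f ` K) \<Longrightarrow> sqnorm (f ` K) (A \<psi>) \<le> c * sqnorm (f ` K) \<psi>"
    using bounded_on_bound[OF A] by metis
  show ?thesis
  proof (rule bounded_onI[where c = c])
    fix \<psi> assume \<psi>: "\<psi> \<in> ell2 K"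
    have "sqnorm K (relabel K f A \<psi>) = sqnorm (f ` K) (A (transport K f \<psi>))"
      by (simp add: sqnorm_transport[OF f, symmetric] transport_relabel[OF f A \<psi>])
    then show "sqnorm K (relabel K f A \<psi>) \<le> c * sqnorm K \<psi>"
      using c[OF transport_ell2[OF \<psi>]] by (simp add: sqnorm_transport[OF f])
    have "zero_ext K (\<lambda>k. A (transport K f \<psi>) (f k)) \<in> ell2 K"
      by (rule ell2_subset_comp[OF bounded_on_ell2[OF A transport_ell2[OF \<psi>]] f]) auto
    then show "relabel K f A \<psi> \<in> ell2 K"
      using \<psi> by (simp add: relabel_def transport_def)
  next
    fix \<phi> \<psi> assume *: "\<phi> \<in> ell2 K" "\<psi> \<in> ell2 K"
    show "relabel K f A (\<lambda>s. \<phi> s + \<psi> s) = (\<lambda>s. relabel K f A \<phi> s + relabel K f A \<psi> s)"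
    proof
      fix k
      show "relabel K f A (\<lambda>s. \<phi> s + \<psi> s) k = relabel K f A \<phi> k + relabel K f A \<psi> k"
        using * by (cases "k \<in> K")
          (simp_all add: relabel_apply relabel_outside ell2_add transport_add bounded_on_add[OF A] transport_ell2)
    qed
  next
    fix c \<psi> assume *: "\<psi> \<in> ell2 K"
    show "relabel K f A (\<lambda>s. c * \<psi> s) = (\<lambda>s. c * relabel K f A \<psi> s)"
    proof
      fix k
      show "relabel K f A (\<lambda>s. c * \<psi> s) k = c * relabel K f A \<psi> k"
        using * by (cases "k \<in> K")
          (simp_all add: relabel_apply relabel_outside ell2_scale transport_scale bounded_on_scale[OF A] transport_ell2)
    qed
  qed (rule relabel_extensional)
qed

lemma relabel_id_op:
  assumes f: "inj_on f K"
  shows "relabel K f (id_op (f ` K)) = id_op K"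
  by (rule relabel_eqI) (simp_all add: id_op_def transport_ell2 transport_apply[OF f] ell2_outside)

lemma relabel_compose:
  assumes f: "inj_on f K" and A: "bounded_on (f ` K) A" and B: "bounded_on (f ` K) B"
  shows "relabel K f (compose (ell2 (f ` K)) A B) = compose (ell2 K) (relabel K f A) (relabel K f B)"
  by (rule relabel_eqI)
    (simp_all add: compose_def transport_ell2 relabel_apply relabel_outside transport_relabel[OF f B]
      bounded_on_ell2[OF bounded_on_relabel[OF f B]])

lemma relabel_ident:
  assumes "bounded_on K A"
  shows "relabel K (\<lambda>k. k) A = A"
proof (rule relabel_eqI)
  fix \<psi> k assume \<psi>: "\<psi> \<in> ell2 K"
  have "transport K (\<lambda>k. k) \<psi> = \<psi>"
    by (rule transport_eqI) (simp_all add: ell2_outside[OF \<psi>])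
  then show "A (transport K (\<lambda>k. k) \<psi>) k = A \<psi> k"
    by simp
qed (simp_all add: bounded_on_extensional[OF assms] ell2_outside[OF bounded_on_ell2[OF assms]])

lemma relabel_relabel:
  assumes f: "inj_on f K" and g: "inj_on g (f ` K)"
  shows "relabel K f (relabel (f ` K) g A) = relabel K (\<lambda>k. g (f k)) A"
proof (rule relabel_eqI[OF relabel_extensional relabel_outside])
  fix \<psi> k assume \<psi>: "\<psi> \<in> ell2 K" and k: "k \<in> K"
  have "transport K (\<lambda>k. g (f k)) \<psi> = transport (f ` K) g (transport K f \<psi>)"
    using comp_inj_on[OF f g]
    by (intro transport_eqI) (auto simp: o_def transport_outside image_image transport_apply[OF g] transport_apply[OF f])
  then show "relabel (f ` K) g A (transport K f \<psi>) (f k) = relabel K (\<lambda>k. g (f k)) A \<psi> k"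
    using \<psi> k by (simp add: relabel_apply transport_ell2)
qed

section \<open>Tensor products of operators on disjoint sets of variables\<close>

text \<open>The general indexings \<open>f\<close> and \<open>g\<close> allow two uses: identities
  give \<open>var_tensor\<close>, and reading off lists gives the tensor product of constants on a
  concatenated register. Slices with fixed first index are the \<open>W\<close>-slices, and
  \<open>tensor_op\<close> treats them first; this fixes the order of the composition.\<close>

lemma relabel_tensor_op:
  fixes X :: "'v \<Rightarrow> 'x set" and f :: "('v \<Rightarrow> 'x) \<Rightarrow> 'i" and g :: "('v \<Rightarrow> 'x) \<Rightarrow> 'j"
  assumes disj: "V \<inter> W = {}" and f: "inj_on f (assigns X V)" and g: "inj_on g (assigns X W)"
    and B: "bounded_on (g ` assigns X W) B"
  shows "relabel (assigns X (V \<union> W)) (\<lambda>\<sigma>. (f (restrict \<sigma> V), g (restrict \<sigma> W)))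
      (tensor_op (f ` assigns X V) (g ` assigns X W) A B) =
    compose (ell2 (assigns X (V \<union> W)))
      (lift X V (V \<union> W) (relabel (assigns X V) f A)) (lift X W (V \<union> W) (relabel (assigns X W) g B))"
    (is "relabel ?K ?h (tensor_op (f ` ?V) (g ` ?W) A B) = compose _ ?A ?B")
proof (rule relabel_eqI)
  have B': "bounded_on ?K ?B"
    by (intro bounded_on_lift bounded_on_relabel g B) auto
  have inv: "restrict (override_on \<rho> \<rho>' W) V = \<rho>" "restrict (override_on \<rho> \<rho>' W) W = \<rho>'"
    "override_on \<rho> \<rho>' W \<in> ?K" if "\<rho> \<in> ?V" "\<rho>' \<in> ?W" for \<rho> \<rho>'
    using that disj by (auto simp: override_on_def PiE_iff extensional_def restrict_def fun_eq_iff)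
  have r: "restrict \<sigma> V \<in> ?V" "restrict \<sigma> W \<in> ?W" if "\<sigma> \<in> ?K" for \<sigma>
    using that by (auto intro: restrict_PiE_subset)
  have h: "inj_on ?h ?K"
  proof (rule inj_onI)
    fix \<sigma> \<tau> assume \<sigma>: "\<sigma> \<in> ?K" and \<tau>: "\<tau> \<in> ?K" and eq: "?h \<sigma> = ?h \<tau>"
    have "restrict \<sigma> V = restrict \<tau> V" "restrict \<sigma> W = restrict \<tau> W"
      using eq inj_onD[OF f _ r(1)[OF \<sigma>] r(1)[OF \<tau>]] inj_onD[OF g _ r(2)[OF \<sigma>] r(2)[OF \<tau>]] by simp_all
    then show "\<sigma> = \<tau>"
      using \<sigma> \<tau> by (intro PiE_ext[OF \<sigma> \<tau>]) (metis Un_iff restrict_apply')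
  qed
  have img: "?h ` ?K = f ` ?V \<times> g ` ?W"
  proof
    show "?h ` ?K \<subseteq> f ` ?V \<times> g ` ?W"
      using r by (intro image_subsetI SigmaI imageI)
    show "f ` ?V \<times> g ` ?W \<subseteq> ?h ` ?K"
    proof
      fix p assume "p \<in> f ` ?V \<times> g ` ?W"
      then obtain \<rho> \<rho>' where p: "p = (f \<rho>, g \<rho>')" "\<rho> \<in> ?V" "\<rho>' \<in> ?W" by blast
      show "p \<in> ?h ` ?K"
        by (rule image_eqI[OF _ inv(3)[OF p(2,3)]]) (simp only: inv[OF p(2,3)] p(1))
    qed
  qed
  fix \<psi> \<sigma> assume \<psi>: "\<psi> \<in> ell2 ?K"
  let ?\<chi> = "transport ?K ?h \<psi>"
  have \<chi>: "?\<chi> \<in> ell2 (f ` ?V \<times> g ` ?W)"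
    using transport_ell2[OF \<psi>, of ?h] by (simp only: img)
  have \<chi>_apply: "?\<chi> (f \<rho>, g \<rho>') = \<psi> (override_on \<rho> \<rho>' W)" if "\<rho> \<in> ?V" "\<rho>' \<in> ?W" for \<rho> \<rho>'
    using transport_apply[OF h inv(3)[OF that], of \<psi>] by (simp only: inv[OF that])
  note LB = bounded_on_ell2[OF B' \<psi>]
  { assume "\<sigma> \<notin> ?K"
    then show "compose (ell2 ?K) ?A ?B \<psi> \<sigma> = 0"
      using \<psi> by (simp add: compose_def lift_outside[OF LB]) }
  assume \<sigma>: "\<sigma> \<in> ?K"
  have row: "transport ?W g (slice X W \<psi> (override_on \<sigma> \<rho> V)) = zero_ext (g ` ?W) (\<lambda>t'. ?\<chi> (f \<rho>, t'))"
    if \<rho>: "\<rho> \<in> ?V" for \<rho>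
  proof (rule transport_eqI[OF g])
    fix \<rho>' assume \<rho>': "\<rho>' \<in> ?W"
    \<comment> \<open>\<open>\<sigma>\<close> is an assignment on \<open>V \<union> W\<close>, so
      nothing of it survives once both parts are overwritten.\<close>
    have "override_on (override_on \<sigma> \<rho> V) \<rho>' W = override_on \<rho> \<rho>' W"
      using \<rho> \<rho>' \<sigma> by (auto simp: override_on_def PiE_iff extensional_def fun_eq_iff)
    then show "zero_ext (g ` ?W) (\<lambda>t'. ?\<chi> (f \<rho>, t')) (g \<rho>') = slice X W \<psi> (override_on \<sigma> \<rho> V) \<rho>'"
      using \<rho>' by (simp only: zero_ext_def[of "g ` ?W"] imageI if_True \<chi>_apply[OF \<rho> \<rho>'] slice_apply)
  qed (simp only: zero_ext_def if_False)
  \<comment> \<open>As a function of its first index, the intermediate result inside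
    \<open>tensor_op\<close> is the transported \<open>V\<close>-slice of the lifted
    \<open>B\<close> applied to \<open>\<psi>\<close>.\<close>
  have column: "transport ?V f (slice X V (?B \<psi>) \<sigma>) =
      zero_ext (f ` ?V) (\<lambda>s'. B (zero_ext (g ` ?W) (\<lambda>t'. ?\<chi> (s', t'))) (g (restrict \<sigma> W)))" (is "_ = ?R")
  proof (rule transport_eqI[OF f])
    fix \<rho> assume \<rho>: "\<rho> \<in> ?V"
    have ov: "override_on \<sigma> \<rho> V \<in> ?K"
      by (rule override_on_PiE[OF disjI2[OF \<sigma>] \<rho> Un_upper1])
    have "?B \<psi> (override_on \<sigma> \<rho> V) =
        relabel ?W g B (slice X W \<psi> (override_on \<sigma> \<rho> V)) (restrict \<sigma> W)"
      by (simp only: lift_apply[OF \<psi> ov] restrict_override_on_disjoint[OF disj])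
    also have "\<dots> = B (zero_ext (g ` ?W) (\<lambda>t'. ?\<chi> (f \<rho>, t'))) (g (restrict \<sigma> W))"
      by (simp only: relabel_apply[OF slice_ell2[OF \<psi> Un_upper2 disjI2[OF ov]] r(2)[OF \<sigma>]] row[OF \<rho>])
    finally show "?R (f \<rho>) = slice X V (?B \<psi>) \<sigma> \<rho>"
      using \<rho> by (simp only: zero_ext_def[of "f ` ?V"] imageI if_True slice_apply)
  qed (simp only: zero_ext_def if_False)
  have "tensor_op (f ` ?V) (g ` ?W) A B ?\<chi> (?h \<sigma>) = A ?R (f (restrict \<sigma> V))"
    unfolding tensor_op_def restrict_apply'[OF \<chi>] using r[OF \<sigma>] by (simp add: zero_ext_def[of "_ \<times> _"])
  also have "\<dots> = ?A (?B \<psi>) \<sigma>"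
    by (simp only: lift_apply[OF LB \<sigma>] column
        relabel_apply[OF slice_ell2[OF LB Un_upper1 disjI2[OF \<sigma>]] r(1)[OF \<sigma>]])
  finally show "tensor_op (f ` ?V) (g ` ?W) A B ?\<chi> (?h \<sigma>) = compose (ell2 ?K) ?A ?B \<psi> \<sigma>"
    using \<psi> by (simp only: compose_def restrict_apply')
qed (rule compose_extensional)

lemma var_tensor_eq_lift:
  assumes "V \<inter> W = {}" and A: "bounded_on (assigns X V) A" and B: "bounded_on (assigns X W) B"
  shows "var_tensor X V W A B =
    compose (ell2 (assigns X (V \<union> W))) (lift X V (V \<union> W) A) (lift X W (V \<union> W) B)"
  using relabel_tensor_op[OF assms(1), of "\<lambda>\<sigma>. \<sigma>" X "\<lambda>\<sigma>. \<sigma>" B A] B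
  by (simp add: var_tensor_def relabel_ident[OF A] relabel_ident[OF B])

lemma bounded_on_var_tensor:
  assumes "V \<inter> W = {}" "bounded_on (assigns X V) A" "bounded_on (assigns X W) B"
  shows "bounded_on (assigns X (V \<union> W)) (var_tensor X V W A B)"
  unfolding var_tensor_eq_lift[OF assms]
  by (intro bounded_on_compose bounded_on_lift assms) auto

lemma compose_id_op:
  assumes "A \<in> extensional (ell2 S)"
  shows "compose (ell2 S) A (id_op S) = A"
  by (rule extensionalityI[OF compose_extensional assms]) (simp add: compose_def id_op_def)

text \<open>The identity factor lifts to the identity on \<open>V \<union> W\<close>, so only the
  lift of \<open>A\<close> remains. The target is the union, which is \<open>W\<close> itself when
  \<open>V \<subseteq> W\<close>.\<close>

lemma extend_eq_lift:
  assumes "bounded_on (assigns X V) A"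
  shows "extend X V W A = lift X V (V \<union> W) A"
proof -
  have "extend X V W A =
      compose (ell2 (assigns X (V \<union> (W - V)))) (lift X V (V \<union> (W - V)) A) (id_op (assigns X (V \<union> (W - V))))"
    unfolding extend_def
    by (subst var_tensor_eq_lift[OF _ assms bounded_on_id]) (simp_all only: Diff_disjoint lift_id[OF Un_upper2])
  also have "\<dots> = lift X V (V \<union> W) A"
    by (simp only: compose_id_op[OF lift_extensional] Un_Diff_cancel)
  finally show ?thesis .
qed

lemma lift_var_tensor:
  assumes "V \<inter> W = {}" "V \<union> W \<subseteq> T" and A: "bounded_on (assigns X V) A" and B: "bounded_on (assigns X W) B"
  shows "lift X (V \<union> W) T (var_tensor X V W A B) =
    compose (ell2 (assigns X T)) (lift X V T A) (lift X W T B)"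
  using assms
  by (simp add: var_tensor_eq_lift lift_compose bounded_on_lift lift_lift)


section \<open>Registers\<close>

lemma listset_iff: "l \<in> listset Xs \<longleftrightarrow> list_all2 (\<in>) l Xs"
  by (induction Xs arbitrary: l) (auto simp: set_Cons_def list_all2_Cons2)

lemma inj_on_map_assigns: "inj_on (\<lambda>\<sigma>. map \<sigma> qs) (assigns X (set qs))"
  by (rule inj_onI) (auto intro: PiE_ext)

text \<open>Distinctness makes every list of admissible values the value list of an assignment:
  lookup in the zipped list then returns \<open>l ! i\<close> at \<open>qs ! i\<close>. With a
  repeated variable only lists with equal entries at its positions would be reached.\<close>

lemma map_image_assigns:
  assumes "distinct qs"
  shows "(\<lambda>\<sigma>. map \<sigma> qs) ` assigns X (set qs) = reg_basis X qs"
proof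
  show "(\<lambda>\<sigma>. map \<sigma> qs) ` assigns X (set qs) \<subseteq> reg_basis X qs"
    by (auto simp: listset_iff list_all2_conv_all_nth PiE_iff)
  show "reg_basis X qs \<subseteq> (\<lambda>\<sigma>. map \<sigma> qs) ` assigns X (set qs)"
  proof
    fix l assume l: "l \<in> reg_basis X qs"
    define \<sigma> where "\<sigma> = (\<lambda>v\<in>set qs. the (map_of (zip qs l) v))"
    have len: "length l = length qs" and nth: "\<And>i. i < length qs \<Longrightarrow> l ! i \<in> X (qs ! i)"
      using l by (auto simp: listset_iff list_all2_conv_all_nth)
    have \<sigma>_nth: "\<sigma> (qs ! i) = l ! i" if "i < length qs" for i
      using that len assms by (simp add: \<sigma>_def map_of_zip_nth)
    have "\<sigma> \<in> assigns X (set qs)"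
      using nth \<sigma>_nth by (auto simp: PiE_iff in_set_conv_nth) (simp add: \<sigma>_def)
    moreover have "map \<sigma> qs = l"
      using len \<sigma>_nth by (auto intro: nth_equalityI)
    ultimately show "l \<in> (\<lambda>\<sigma>. map \<sigma> qs) ` assigns X (set qs)"
      by (intro image_eqI) auto
  qed
qed

lemma bounded_on_on_reg:
  "distinct qs \<Longrightarrow> bounded_on (reg_basis X qs) A \<Longrightarrow> bounded_on (assigns X (set qs)) (on_reg X qs A)"
  by (simp add: on_reg_def bounded_on_relabel inj_on_map_assigns map_image_assigns)

lemma on_reg_id_op: "distinct qs \<Longrightarrow> on_reg X qs (id_op (reg_basis X qs)) = id_op (assigns X (set qs))"
  using relabel_id_op[OF inj_on_map_assigns, of qs X] by (simp add: on_reg_def map_image_assigns)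

lemma on_reg_compose:
  assumes "distinct qs" "bounded_on (reg_basis X qs) A" "bounded_on (reg_basis X qs) B"
  shows "on_reg X qs (compose (ell2 (reg_basis X qs)) A B) =
    compose (ell2 (assigns X (set qs))) (on_reg X qs A) (on_reg X qs B)"
  using relabel_compose[OF inj_on_map_assigns, of qs X A B] assms by (simp add: on_reg_def map_image_assigns)

text \<open>The two relabellings merge into one, which sends \<open>\<sigma>\<close> to its value
  lists on \<open>qs\<close> and on \<open>rs\<close>. That is the map of
  \<open>relabel_tensor_op\<close> with list indexings.\<close>

lemma on_reg_tensor_op:
  assumes dist: "distinct (qs @ rs)" and A: "bounded_on (reg_basis X qs) A" and B: "bounded_on (reg_basis X rs) B"
  shows "on_reg X (qs @ rs) (relabel (reg_basis X (qs @ rs)) (\<lambda>l. (take (length qs) l, drop (length qs) l))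
      (tensor_op (reg_basis X qs) (reg_basis X rs) A B)) =
    var_tensor X (set qs) (set rs) (on_reg X qs A) (on_reg X rs B)"
proof -
  let ?K = "assigns X (set (qs @ rs))" and ?split = "\<lambda>l. (take (length qs) l, drop (length qs) l)"
  have d: "distinct qs" "distinct rs" "set qs \<inter> set rs = {}"
    using dist by auto
  have split: "inj_on ?split (reg_basis X (qs @ rs))"
    by (rule inj_on_inverseI[where g = "\<lambda>(l, m). l @ m"]) simp
  have "on_reg X (qs @ rs) (relabel (reg_basis X (qs @ rs)) ?split
      (tensor_op (reg_basis X qs) (reg_basis X rs) A B)) =
    relabel ?K (\<lambda>\<sigma>. ?split (map \<sigma> (qs @ rs))) (tensor_op (reg_basis X qs) (reg_basis X rs) A B)"
    using relabel_relabel[OF inj_on_map_assigns[of "qs @ rs" X], of ?split] split map_image_assigns[OF dist, of X]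
    unfolding on_reg_def by simp
  also have "(\<lambda>\<sigma>. ?split (map \<sigma> (qs @ rs))) =
      (\<lambda>\<sigma>. (map (restrict \<sigma> (set qs)) qs, map (restrict \<sigma> (set rs)) rs))"
    by (auto simp: fun_eq_iff)
  finally show ?thesis
    using relabel_tensor_op[OF d(3) inj_on_map_assigns[of qs X] inj_on_map_assigns[of rs X], of B A] A B d
    by (simp add: map_image_assigns var_tensor_eq_lift bounded_on_on_reg on_reg_def[symmetric])
qed

text \<open>The right-hand side is the operator \<open>|\<phi>><\<chi>|\<close> scaled by the inner
  product of \<open>\<phi>\<close> and \<open>\<chi>\<close>. Idempotence and orthogonality are its
  cases 1 and 0.\<close>

lemma proj_op_compose:
  assumes "\<phi> \<in> ell2 S" "\<chi> \<in> ell2 S"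
  shows "compose (ell2 S) (proj_op S \<phi>) (proj_op S \<chi>) =
    (\<lambda>\<psi>\<in>ell2 S. \<lambda>s. inner_prod S \<phi> \<chi> * inner_prod S \<chi> \<psi> * \<phi> s)"
  using assms by (auto simp: compose_def proj_op_def ell2_scale inner_prod_scale fun_eq_iff)


section \<open>Semantics of well-formed circuits\<close>

definition act :: "('v \<Rightarrow> 'x set) \<Rightarrow> 'v set \<Rightarrow> ('v, 'x) circuit \<Rightarrow> ('v \<Rightarrow> 'x) oper" where
  "act X T C = lift X (qv C) T (sem X C)"

definition guard :: "('v \<Rightarrow> 'x set) \<Rightarrow> 'v set \<Rightarrow> 'v list \<Rightarrow> 'x list vec \<Rightarrow> ('v \<Rightarrow> 'x) oper" where
  "guard X T qs \<phi> = lift X (set qs) T (on_reg X qs (proj_op (reg_basis X qs) \<phi>))"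

lemma act_Skip: "act X T Skip = id_op (assigns X T)"
  \<comment> \<open>\<open>PiE_empty_domain\<close> would rewrite the one-point index set of
    \<open>Skip\<close> to a singleton and hide the pattern of \<open>lift_id\<close>.\<close>
  by (simp add: act_def lift_id del: PiE_empty_domain)

text \<open>Brings the semantics into the form of a sum over a list of operators, to which
  \<open>bounded_on_sum_list\<close> and \<open>lift_sum_list\<close> apply.\<close>

lemma sem_Qif:
  "sem X (Qif qs bs) = (\<lambda>\<psi>\<in>ell2 (assigns X (qv (Qif qs bs))). \<lambda>\<sigma>.
     \<Sum>A\<leftarrow>map (\<lambda>(\<phi>, C). var_tensor X (set qs) (\<Union>(\<phi>, C)\<in>set bs. qv C)
       (on_reg X qs (proj_op (reg_basis X qs) \<phi>))
       (extend X (qv C) (\<Union>(\<phi>, C)\<in>set bs. qv C) (sem X C))) bs. A \<psi> \<sigma>)"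
  by (simp add: Let_def o_def case_prod_unfold)

lemma orthonormal_basis_guard:
  "orthonormal_basis S (map fst bs) \<Longrightarrow> (\<phi>, C) \<in> set bs \<Longrightarrow> \<phi> \<in> ell2 S"
  by (force simp: orthonormal_basis_def)

locale gate_set =
  fixes X :: "'v \<Rightarrow> 'x set" and \<U> :: "'x uconst set"
  assumes unitary: "\<forall>U\<in>\<U>. uconst_ok U"
begin

abbreviation wf_circ :: "('v, 'x) circuit \<Rightarrow> bool" where
  "wf_circ \<equiv> well_formed X \<U>"

lemma bounded_on_gate: "wf_circ (Gate U qs) \<Longrightarrow> bounded_on (reg_basis X qs) (uop U)"
  using unitary by (auto simp: uconst_ok_def intro!: bounded_on_unitary)

lemma bounded_on_extend:
  assumes "bounded_on (assigns X V) A"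
  shows "bounded_on (assigns X (V \<union> W)) (extend X V W A)"
  unfolding extend_eq_lift[OF assms] by (rule bounded_on_lift[OF Un_upper1 assms])

text \<open>Boundedness of the branch is a hypothesis because these facts already serve inside the
  induction that establishes boundedness.\<close>

lemma Qif_branch:
  assumes "wf_circ (Qif qs bs)" "(\<phi>, C) \<in> set bs" and C: "bounded_on (assigns X (qv C)) (sem X C)"
  defines "W \<equiv> \<Union>(\<phi>, C)\<in>set bs. qv C"
  shows "set qs \<inter> W = {}" "qv C \<union> W = W" "wf_circ C"
    "bounded_on (assigns X (set qs)) (on_reg X qs (proj_op (reg_basis X qs) \<phi>))"
    "bounded_on (assigns X W) (extend X (qv C) W (sem X C))"
proof -
  show "set qs \<inter> W = {}" "wf_circ C"
    using assms by fastforce+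
  show W: "qv C \<union> W = W"
    using assms(2) unfolding W_def by blast
  show "bounded_on (assigns X (set qs)) (on_reg X qs (proj_op (reg_basis X qs) \<phi>))"
    using assms(1) orthonormal_basis_guard[OF _ assms(2)] by (auto intro!: bounded_on_on_reg bounded_on_proj)
  show "bounded_on (assigns X W) (extend X (qv C) W (sem X C))"
    using bounded_on_extend[OF C, of W] by (simp only: W)
qed

text \<open>In the \<open>Qif\<close> case each branch is a projection tensored with an operator
  bounded by induction, and a finite sum of such operators remains bounded.\<close>

lemma bounded_on_sem: "wf_circ C \<Longrightarrow> bounded_on (assigns X (qv C)) (sem X C)"
proof (induction C)
  case Skip
  then show ?case
    by (simp add: bounded_on_id del: PiE_empty_domain)
next
  case (Gate U qs)
  then show ?case
    using bounded_on_gate[of U qs] by (simp add: bounded_on_on_reg)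
next
  case (Seq C D)
  then have "bounded_on (assigns X (qv C)) (sem X C)" "bounded_on (assigns X (qv D)) (sem X D)"
    by simp_all
  from bounded_on_extend[OF this(1), of "qv C \<union> qv D"] bounded_on_extend[OF this(2), of "qv C \<union> qv D"]
  show ?case
    by (simp add: bounded_on_compose Un_left_commute)
next
  case (Qif qs bs)
  let ?W = "\<Union>(\<phi>, C)\<in>set bs. qv C"
  have "bounded_on (assigns X (set qs \<union> ?W)) (var_tensor X (set qs) ?W
      (on_reg X qs (proj_op (reg_basis X qs) \<phi>)) (extend X (qv C) ?W (sem X C)))"
    if b: "(\<phi>, C) \<in> set bs" for \<phi> C
  proof -
    have C: "bounded_on (assigns X (qv C)) (sem X C)"
      using Qif.prems b by (intro Qif.IH[OF b]) auto
    note br = Qif_branch[OF Qif.prems b C]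
    show ?thesis
      by (rule bounded_on_var_tensor[OF br(1,4,5)])
  qed
  then show ?case
    unfolding sem_Qif by (intro bounded_on_sum_list) auto
qed

lemma bounded_on_act: "wf_circ C \<Longrightarrow> qv C \<subseteq> T \<Longrightarrow> bounded_on (assigns X T) (act X T C)"
  unfolding act_def by (intro bounded_on_lift bounded_on_sem)

lemma act_Gate: "act X T (Gate U qs) = lift X (set qs) T (on_reg X qs (uop U))"
  by (simp add: act_def)

lemma act_Seq:
  assumes "wf_circ (Seq C D)" "qv (Seq C D) \<subseteq> T"
  shows "act X T (Seq C D) = compose (ell2 (assigns X T)) (act X T D) (act X T C)"
proof -
  let ?V = "qv C \<union> qv D"
  have b: "bounded_on (assigns X (qv C)) (sem X C)" "bounded_on (assigns X (qv D)) (sem X D)"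
    using assms by (auto intro: bounded_on_sem)
  have ext: "extend X (qv C) ?V (sem X C) = lift X (qv C) ?V (sem X C)"
    "extend X (qv D) ?V (sem X D) = lift X (qv D) ?V (sem X D)"
    by (simp_all add: extend_eq_lift b Un_left_commute)
  have "act X T (Seq C D) = lift X ?V T (compose (ell2 (assigns X ?V))
      (lift X (qv D) ?V (sem X D)) (lift X (qv C) ?V (sem X C)))"
    by (simp add: act_def ext)
  also have "\<dots> = compose (ell2 (assigns X T)) (lift X ?V T (lift X (qv D) ?V (sem X D)))
      (lift X ?V T (lift X (qv C) ?V (sem X C)))"
    using assms(2) b by (intro lift_compose bounded_on_lift) auto
  finally show ?thesis
    using assms(2) by (simp add: lift_lift act_def)
qed

lemma act_Seq_apply:
  "wf_circ (Seq C D) \<Longrightarrow> qv (Seq C D) \<subseteq> T \<Longrightarrow> \<psi> \<in> ell2 (assigns X T) \<Longrightarrow>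
    act X T (Seq C D) \<psi> = act X T D (act X T C \<psi>)"
  by (simp add: act_Seq compose_def)

text \<open>The guard stands outside the branch because \<open>var_tensor\<close> lets its second
  factor act first. The extension of a branch to the variables of all branches and then to
  \<open>T\<close> collapses by \<open>lift_lift\<close>.\<close>

lemma act_Qif:
  assumes wf: "wf_circ (Qif qs bs)" and T: "qv (Qif qs bs) \<subseteq> T" and \<psi>: "\<psi> \<in> ell2 (assigns X T)"
  shows "act X T (Qif qs bs) \<psi> = (\<lambda>\<sigma>. \<Sum>(\<phi>, C)\<leftarrow>bs. guard X T qs \<phi> (act X T C \<psi>) \<sigma>)"
proof
  fix \<sigma>
  let ?W = "\<Union>(\<phi>, C)\<in>set bs. qv C"
  let ?B = "\<lambda>(\<phi>, C). var_tensor X (set qs) ?W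
       (on_reg X qs (proj_op (reg_basis X qs) \<phi>)) (extend X (qv C) ?W (sem X C))"
  have branch: "lift X (set qs \<union> ?W) T (?B (\<phi>, C)) \<psi> = guard X T qs \<phi> (act X T C \<psi>)"
    if b: "(\<phi>, C) \<in> set bs" for \<phi> C
  proof -
    have C: "bounded_on (assigns X (qv C)) (sem X C)"
      using wf b by (intro bounded_on_sem) auto
    note br = Qif_branch[OF wf b C]
    have W: "qv C \<subseteq> ?W" "?W \<subseteq> T" "set qs \<union> ?W \<subseteq> T"
      using b T by auto
    have "lift X ?W T (extend X (qv C) ?W (sem X C)) = act X T C"
      unfolding extend_eq_lift[OF C] br(2) act_def by (rule lift_lift[OF W(1,2)])
    then show ?thesis
      using \<psi> by (simp add: lift_var_tensor[OF br(1) W(3) br(4,5)] guard_def compose_def)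
  qed
  have "act X T (Qif qs bs) \<psi> \<sigma> = (\<Sum>A\<leftarrow>map ?B bs. lift X (set qs \<union> ?W) T A \<psi> \<sigma>)"
    using \<psi> lift_sum_list[OF T, of X "map ?B bs"] unfolding act_def sem_Qif by simp
  also have "\<dots> = (\<Sum>(\<phi>, C)\<leftarrow>bs. guard X T qs \<phi> (act X T C \<psi>) \<sigma>)"
    using branch by (auto simp: o_def intro!: arg_cong[where f = sum_list])
  finally show "act X T (Qif qs bs) \<psi> \<sigma> = (\<Sum>(\<phi>, C)\<leftarrow>bs. guard X T qs \<phi> (act X T C \<psi>) \<sigma>)" .
qed

lemma act_qif2:
  assumes "wf_circ (qif2 \<phi>0 \<phi>1 q C0 C1)" "qv (qif2 \<phi>0 \<phi>1 q C0 C1) \<subseteq> T" "\<psi> \<in> ell2 (assigns X T)"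
  shows "act X T (qif2 \<phi>0 \<phi>1 q C0 C1) \<psi> =
    (\<lambda>\<sigma>. guard X T [q] \<phi>0 (act X T C0 \<psi>) \<sigma> + guard X T [q] \<phi>1 (act X T C1 \<psi>) \<sigma>)"
  by (simp add: act_Qif[OF assms])

lemma act_commute:
  assumes "wf_circ C" "wf_circ D" "qv C \<inter> qv D = {}" "qv C \<subseteq> T" "qv D \<subseteq> T" "\<psi> \<in> ell2 (assigns X T)"
  shows "act X T C (act X T D \<psi>) = act X T D (act X T C \<psi>)"
  unfolding act_def using assms by (intro lift_lift_commute bounded_on_sem)

text \<open>Both sides of \<open>circ_equiv\<close> are instances of \<open>extend\<close>, hence
  lifts to the union of the variables. \<open>T\<close> is a separate variable so that the union can
  be written in a convenient form.\<close>

lemma circ_equivI: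
  assumes C: "wf_circ C" and D: "wf_circ D" and T: "T = qv C \<union> qv D"
    and eq: "\<And>\<psi>. \<psi> \<in> ell2 (assigns X T) \<Longrightarrow> act X T C \<psi> = act X T D \<psi>"
  shows "circ_equiv X C D"
proof -
  have "var_tensor X (qv C) (qv D - qv C) (sem X C) (id_op (assigns X (qv D - qv C))) = act X T C"
    using extend_eq_lift[OF bounded_on_sem[OF C]] by (simp add: extend_def act_def T)
  moreover have "var_tensor X (qv D) (qv C - qv D) (sem X D) (id_op (assigns X (qv C - qv D))) = act X T D"
    using extend_eq_lift[OF bounded_on_sem[OF D]] by (simp add: extend_def act_def T Un_commute)
  moreover have "act X T C = act X T D"
    by (rule extensionalityI[of _ "ell2 (assigns X T)"]) (auto simp: act_def lift_extensional eq[unfolded act_def])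
  ultimately show ?thesis
    by (simp add: circ_equiv_def)
qed

end

section \<open>Algebra of the guard projections\<close>

context
  fixes X :: "'v \<Rightarrow> 'x set" and qs :: "'v list" and T :: "'v set"
  assumes dist: "distinct qs" and T: "set qs \<subseteq> T"
begin

lemma bounded_on_guard: "\<phi> \<in> ell2 (reg_basis X qs) \<Longrightarrow> bounded_on (assigns X T) (guard X T qs \<phi>)"
  unfolding guard_def by (intro bounded_on_lift[OF T] bounded_on_on_reg[OF dist] bounded_on_proj)

text \<open>The product is computed on the register by \<open>proj_op_compose\<close> and carried to
  \<open>T\<close>, since \<open>on_reg\<close> and \<open>lift\<close> respect composition.\<close>

lemma guard_guard:
  assumes \<phi>: "\<phi> \<in> ell2 (reg_basis X qs)" and \<chi>: "\<chi> \<in> ell2 (reg_basis X qs)" and \<psi>: "\<psi> \<in> ell2 (assigns X T)"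
  shows "guard X T qs \<phi> (guard X T qs \<chi> \<psi>) = lift X (set qs) T (on_reg X qs
    (\<lambda>\<psi>\<in>ell2 (reg_basis X qs). \<lambda>s. inner_prod (reg_basis X qs) \<phi> \<chi> * inner_prod (reg_basis X qs) \<chi> \<psi> * \<phi> s)) \<psi>"
proof -
  note b = bounded_on_proj[OF \<phi>] bounded_on_proj[OF \<chi>]
  have "lift X (set qs) T (on_reg X qs (compose (ell2 (reg_basis X qs))
      (proj_op (reg_basis X qs) \<phi>) (proj_op (reg_basis X qs) \<chi>))) =
    compose (ell2 (assigns X T)) (guard X T qs \<phi>) (guard X T qs \<chi>)"
    unfolding guard_def on_reg_compose[OF dist b]
    by (rule lift_compose[OF T]) (intro bounded_on_on_reg[OF dist] b)+
  from fun_cong[OF this, of \<psi>] show ?thesis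
    using \<psi> unfolding proj_op_compose[OF \<phi> \<chi>] by (simp add: compose_def)
qed

lemma guard_idem:
  assumes "\<phi> \<in> ell2 (reg_basis X qs)" "inner_prod (reg_basis X qs) \<phi> \<phi> = 1" "\<psi> \<in> ell2 (assigns X T)"
  shows "guard X T qs \<phi> (guard X T qs \<phi> \<psi>) = guard X T qs \<phi> \<psi>"
  using assms by (simp add: guard_guard) (simp add: guard_def proj_op_def)

lemma guard_orthogonal:
  assumes "\<phi> \<in> ell2 (reg_basis X qs)" "\<chi> \<in> ell2 (reg_basis X qs)" "inner_prod (reg_basis X qs) \<phi> \<chi> = 0"
    "\<psi> \<in> ell2 (assigns X T)"
  shows "guard X T qs \<phi> (guard X T qs \<chi> \<psi>) = (\<lambda>\<sigma>. 0)"
proof -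
  \<comment> \<open>The zero operator is extensional, so it returns 0 only on vectors of its space.
    Membership of the transported vector, and below of the slice, has to be supplied.\<close>
  have "on_reg X qs (\<lambda>\<psi>\<in>ell2 (reg_basis X qs). \<lambda>s. 0) \<chi> \<rho> = 0" if "\<chi> \<in> ell2 (assigns X (set qs))" for \<chi> \<rho>
    using that transport_ell2[OF that, of "\<lambda>\<sigma>. map \<sigma> qs"]
    by (cases "\<rho> \<in> assigns X (set qs)")
      (simp_all add: on_reg_def relabel_apply relabel_outside map_image_assigns[OF dist])
  then have "lift X (set qs) T (on_reg X qs (\<lambda>\<psi>\<in>ell2 (reg_basis X qs). \<lambda>s. 0)) \<psi> \<sigma> = 0" for \<sigma>
    using assms(4) by (cases "\<sigma> \<in> assigns X T") (simp_all add: lift_apply lift_outside slice_ell2[OF _ T])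
  then show ?thesis
    using assms by (simp add: guard_guard fun_eq_iff)
qed

end

lemma (in gate_set) act_guard_commute:
  assumes "wf_circ C" "qv C \<inter> set qs = {}" "qv C \<subseteq> T" "set qs \<subseteq> T" "distinct qs"
    "\<phi> \<in> ell2 (reg_basis X qs)" "\<psi> \<in> ell2 (assigns X T)"
  shows "act X T C (guard X T qs \<phi> \<psi>) = guard X T qs \<phi> (act X T C \<psi>)"
  unfolding act_def guard_def using assms
  by (intro lift_lift_commute bounded_on_sem bounded_on_on_reg bounded_on_proj)


section \<open>Circuit equivalences\<close>

context gate_set
begin

lemma Skip_Seq_equiv:
  assumes "wf_circ C"
  shows "circ_equiv X (Seq Skip C) (Seq C Skip)"
proof (rule circ_equivI[OF _ _ refl])
  fix \<psi> assume "\<psi> \<in> ell2 (assigns X (qv (Seq Skip C) \<union> qv (Seq C Skip)))"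
  then show "act X (qv (Seq Skip C) \<union> qv (Seq C Skip)) (Seq Skip C) \<psi> =
      act X (qv (Seq Skip C) \<union> qv (Seq C Skip)) (Seq C Skip) \<psi>"
    using assms by (simp add: act_Seq_apply act_Skip id_op_def bounded_on_ell2[OF bounded_on_act])
qed (use assms in auto)

lemma Seq_Skip_equiv:
  assumes "wf_circ C"
  shows "circ_equiv X (Seq C Skip) C"
proof (rule circ_equivI[OF _ _ refl])
  fix \<psi> assume "\<psi> \<in> ell2 (assigns X (qv (Seq C Skip) \<union> qv C))"
  then show "act X (qv (Seq C Skip) \<union> qv C) (Seq C Skip) \<psi> = act X (qv (Seq C Skip) \<union> qv C) C \<psi>"
    using assms by (simp add: act_Seq_apply act_Skip id_op_def bounded_on_ell2[OF bounded_on_act])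
qed (use assms in auto)

lemma Gate_id_equiv:
  assumes "wf_circ (Gate (u_id (map X qs)) qs)"
  shows "circ_equiv X (Gate (u_id (map X qs)) qs) Skip"
proof (rule circ_equivI[OF assms _ refl])
  show "act X (qv (Gate (u_id (map X qs)) qs) \<union> qv Skip) (Gate (u_id (map X qs)) qs) \<psi> =
      act X (qv (Gate (u_id (map X qs)) qs) \<union> qv Skip) Skip \<psi>" for \<psi>
    using assms by (simp add: act_Gate act_Skip u_id_def on_reg_id_op lift_id)
qed simp

lemma Gate_mult_equiv:
  assumes wf: "wf_circ (Seq (Gate U1 qs) (Gate U2 qs))" "wf_circ (Gate (u_mult U2 U1) qs)"
  shows "circ_equiv X (Seq (Gate U1 qs) (Gate U2 qs)) (Gate (u_mult U2 U1) qs)"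
proof (rule circ_equivI[OF wf])
  show "set qs = qv (Seq (Gate U1 qs) (Gate U2 qs)) \<union> qv (Gate (u_mult U2 U1) qs)"
    by simp
  fix \<psi> assume \<psi>: "\<psi> \<in> ell2 (assigns X (set qs))"
  have dist: "distinct qs" and ty: "utype U1 = map X qs"
    and b: "bounded_on (reg_basis X qs) (uop U1)" "bounded_on (reg_basis X qs) (uop U2)"
    using wf(1) bounded_on_gate[of U1 qs] bounded_on_gate[of U2 qs] by auto
  have "on_reg X qs (uop (u_mult U2 U1)) =
      compose (ell2 (assigns X (set qs))) (on_reg X qs (uop U2)) (on_reg X qs (uop U1))"
    by (simp add: u_mult_def ty on_reg_compose[OF dist b(2,1)])
  then have "act X (set qs) (Gate (u_mult U2 U1) qs) =
      compose (ell2 (assigns X (set qs))) (act X (set qs) (Gate U2 qs)) (act X (set qs) (Gate U1 qs))"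
    unfolding act_Gate by (simp add: lift_compose bounded_on_on_reg dist b)
  then show "act X (set qs) (Seq (Gate U1 qs) (Gate U2 qs)) \<psi> = act X (set qs) (Gate (u_mult U2 U1) qs) \<psi>"
    using wf by (simp add: act_Seq)
qed

lemma Seq_commute_equiv:
  assumes disj: "qv C \<inter> qv D = {}" and wf: "wf_circ (Seq C D)" "wf_circ (Seq D C)"
  shows "circ_equiv X (Seq C D) (Seq D C)"
proof (rule circ_equivI[OF wf])
  show "qv C \<union> qv D = qv (Seq C D) \<union> qv (Seq D C)"
    by auto
  fix \<psi> assume "\<psi> \<in> ell2 (assigns X (qv C \<union> qv D))"
  then show "act X (qv C \<union> qv D) (Seq C D) \<psi> = act X (qv C \<union> qv D) (Seq D C) \<psi>"
    using wf act_commute[of C D "qv C \<union> qv D" \<psi>] disj by (simp add: act_Seq_apply)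
qed

text \<open>The tensor product applies its second factor first, so it matches directly the sequence
  that starts with \<open>U2\<close>. The other order is a case of
  \<open>Seq_commute_equiv\<close>.\<close>

lemma Gate_tensor_equiv:
  assumes wf: "wf_circ (Seq (Gate U2 rs) (Gate U1 qs))" "wf_circ (Gate (u_tensor U1 U2) (qs @ rs))"
  shows "circ_equiv X (Seq (Gate U2 rs) (Gate U1 qs)) (Gate (u_tensor U1 U2) (qs @ rs))"
proof (rule circ_equivI[OF wf])
  let ?T = "set qs \<union> set rs"
  show "?T = qv (Seq (Gate U2 rs) (Gate U1 qs)) \<union> qv (Gate (u_tensor U1 U2) (qs @ rs))"
    by auto
  fix \<psi> assume \<psi>: "\<psi> \<in> ell2 (assigns X ?T)"
  have dist: "distinct (qs @ rs)" and ty: "utype U1 = map X qs" "utype U2 = map X rs"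
    and b: "bounded_on (reg_basis X qs) (uop U1)" "bounded_on (reg_basis X rs) (uop U2)"
    using wf bounded_on_gate[of U1 qs] bounded_on_gate[of U2 rs] by auto
  have d: "distinct qs" "distinct rs" "set qs \<inter> set rs = {}"
    using dist by auto
  note b' = bounded_on_on_reg[OF d(1) b(1)] bounded_on_on_reg[OF d(2) b(2)]
  have tensor: "on_reg X (qs @ rs) (uop (u_tensor U1 U2)) =
      var_tensor X (set qs) (set rs) (on_reg X qs (uop U1)) (on_reg X rs (uop U2))"
    using on_reg_tensor_op[OF dist b] by (simp add: u_tensor_def ty)
  have "act X ?T (Gate (u_tensor U1 U2) (qs @ rs)) =
      compose (ell2 (assigns X ?T)) (act X ?T (Gate U1 qs)) (act X ?T (Gate U2 rs))"
    unfolding act_Gate tensor set_append by (rule lift_var_tensor[OF d(3) order_refl b'])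
  then show "act X ?T (Seq (Gate U2 rs) (Gate U1 qs)) \<psi> = act X ?T (Gate (u_tensor U1 U2) (qs @ rs)) \<psi>"
    using wf by (simp add: act_Seq)
qed

lemma Seq_assoc_equiv:
  assumes wf: "wf_circ (Seq (Seq C D) E)" "wf_circ (Seq C (Seq D E))"
  shows "circ_equiv X (Seq (Seq C D) E) (Seq C (Seq D E))"
proof (rule circ_equivI[OF wf])
  let ?T = "qv C \<union> qv D \<union> qv E"
  show "?T = qv (Seq (Seq C D) E) \<union> qv (Seq C (Seq D E))"
    by auto
  fix \<psi> assume \<psi>: "\<psi> \<in> ell2 (assigns X ?T)"
  have wf': "wf_circ C" "wf_circ D" "wf_circ E" and sub: "qv C \<subseteq> ?T" "qv D \<subseteq> ?T" "qv E \<subseteq> ?T"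
    using wf by auto
  show "act X ?T (Seq (Seq C D) E) \<psi> = act X ?T (Seq C (Seq D E)) \<psi>"
    using \<psi> wf' sub bounded_on_ell2[OF bounded_on_act[OF wf'(1) sub(1)] \<psi>] by (simp add: act_Seq_apply)
qed

lemma qif2_wfD:
  assumes "wf_circ (qif2 \<phi>0 \<phi>1 q C0 C1)"
  shows "wf_circ C0" "wf_circ C1" "q \<notin> qv C0" "q \<notin> qv C1"
    "\<phi>0 \<in> ell2 (reg_basis X [q])" "\<phi>1 \<in> ell2 (reg_basis X [q])"
  using assms by (auto simp: orthonormal_basis_def)

text \<open>With \<open>P\<close> for the guards, \<open>P0 D0 (P0 C0 + P1 C1) = D0 P0 (P0 C0 + P1
  C1) = D0 P0 C0 = P0 D0 C0\<close>, and likewise for index 1. Moving \<open>P0\<close> and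
  \<open>P1\<close> past the branches rests on \<open>q\<close> not occurring in them.\<close>

lemma qif2_Seq_equiv:
  assumes onb: "orthonormal_basis (reg_basis X [q]) [\<phi>0, \<phi>1]"
    and wf: "wf_circ (Seq (qif2 \<phi>0 \<phi>1 q C0 C1) (qif2 \<phi>0 \<phi>1 q D0 D1))" "wf_circ (qif2 \<phi>0 \<phi>1 q (Seq C0 D0) (Seq C1 D1))"
  shows "circ_equiv X (Seq (qif2 \<phi>0 \<phi>1 q C0 C1) (qif2 \<phi>0 \<phi>1 q D0 D1)) (qif2 \<phi>0 \<phi>1 q (Seq C0 D0) (Seq C1 D1))"
proof (rule circ_equivI[OF wf])
  let ?T = "{q} \<union> qv C0 \<union> qv C1 \<union> qv D0 \<union> qv D1"
  show "?T = qv (Seq (qif2 \<phi>0 \<phi>1 q C0 C1) (qif2 \<phi>0 \<phi>1 q D0 D1)) \<union> qv (qif2 \<phi>0 \<phi>1 q (Seq C0 D0) (Seq C1 D1))"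
    by auto
  fix \<psi> assume \<psi>: "\<psi> \<in> ell2 (assigns X ?T)"
  have wfC: "wf_circ (qif2 \<phi>0 \<phi>1 q C0 C1)" and wfD: "wf_circ (qif2 \<phi>0 \<phi>1 q D0 D1)"
    using wf(1) by simp_all
  note C = qif2_wfD[OF wfC] and D = qif2_wfD[OF wfD]
  let ?P = "guard X ?T [q]" and ?A = "act X ?T"
  have ip: "inner_prod (reg_basis X [q]) \<phi>0 \<phi>0 = 1" "inner_prod (reg_basis X [q]) \<phi>1 \<phi>1 = 1"
    "inner_prod (reg_basis X [q]) \<phi>0 \<phi>1 = 0" "inner_prod (reg_basis X [q]) \<phi>1 \<phi>0 = 0"
    using onb by (auto simp: orthonormal_basis_def All_less_Suc)
  have q: "distinct [q]" "set [q] \<subseteq> ?T"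
    by auto
  note guard = bounded_on_guard[OF q]
  define \<psi>0 \<psi>1 where "\<psi>0 = ?A C0 \<psi>" and "\<psi>1 = ?A C1 \<psi>"
  define \<chi> where "\<chi> = (\<lambda>\<sigma>. ?P \<phi>0 \<psi>0 \<sigma> + ?P \<phi>1 \<psi>1 \<sigma>)"
  have in0: "\<psi>0 \<in> ell2 (assigns X ?T)"
    unfolding \<psi>0_def by (rule bounded_on_ell2[OF bounded_on_act[OF C(1)] \<psi>]) auto
  have in1: "\<psi>1 \<in> ell2 (assigns X ?T)"
    unfolding \<psi>1_def by (rule bounded_on_ell2[OF bounded_on_act[OF C(2)] \<psi>]) auto
  note g0 = bounded_on_ell2[OF guard[OF C(5)] in0] and g1 = bounded_on_ell2[OF guard[OF C(6)] in1]
  have \<chi>: "\<chi> \<in> ell2 (assigns X ?T)"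
    unfolding \<chi>_def by (rule ell2_add[OF g0 g1])
  \<comment> \<open>Applied to the output of the first \<open>Qif\<close>, each guard selects its
    own branch: the cross term vanishes by orthogonality.\<close>
  have P: "?P \<phi>0 \<chi> = ?P \<phi>0 \<psi>0" "?P \<phi>1 \<chi> = ?P \<phi>1 \<psi>1"
    unfolding \<chi>_def bounded_on_add[OF guard[OF C(5)] g0 g1] bounded_on_add[OF guard[OF C(6)] g0 g1]
      guard_idem[OF q C(5) ip(1) in0] guard_idem[OF q C(6) ip(2) in1]
      guard_orthogonal[OF q C(5,6) ip(3) in1] guard_orthogonal[OF q C(6,5) ip(4) in0]
    by simp_all
  have comm0: "?P \<phi>0 (?A D0 \<xi>) = ?A D0 (?P \<phi>0 \<xi>)" if "\<xi> \<in> ell2 (assigns X ?T)" for \<xi>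
    by (rule act_guard_commute[symmetric]) (use that C D in auto)
  have comm1: "?P \<phi>1 (?A D1 \<xi>) = ?A D1 (?P \<phi>1 \<xi>)" if "\<xi> \<in> ell2 (assigns X ?T)" for \<xi>
    by (rule act_guard_commute[symmetric]) (use that C D in auto)
  have "?A (Seq (qif2 \<phi>0 \<phi>1 q C0 C1) (qif2 \<phi>0 \<phi>1 q D0 D1)) \<psi> = ?A (qif2 \<phi>0 \<phi>1 q D0 D1) (?A (qif2 \<phi>0 \<phi>1 q C0 C1) \<psi>)"
    by (rule act_Seq_apply[OF wf(1) _ \<psi>]) auto
  also have "?A (qif2 \<phi>0 \<phi>1 q C0 C1) \<psi> = \<chi>"
    unfolding \<chi>_def \<psi>0_def \<psi>1_def by (rule act_qif2[OF wfC _ \<psi>]) auto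
  also have "?A (qif2 \<phi>0 \<phi>1 q D0 D1) \<chi> = (\<lambda>\<sigma>. ?P \<phi>0 (?A D0 \<chi>) \<sigma> + ?P \<phi>1 (?A D1 \<chi>) \<sigma>)"
    by (rule act_qif2[OF wfD _ \<chi>]) auto
  \<comment> \<open>Each guard is moved inside to meet \<open>\<chi>\<close>, reduces it to one
    branch, and is moved back out.\<close>
  also have "\<dots> = (\<lambda>\<sigma>. ?P \<phi>0 (?A D0 \<psi>0) \<sigma> + ?P \<phi>1 (?A D1 \<psi>1) \<sigma>)"
    unfolding comm0[OF \<chi>] comm1[OF \<chi>] comm0[OF in0] comm1[OF in1] P ..
  also have "\<dots> = (\<lambda>\<sigma>. ?P \<phi>0 (?A (Seq C0 D0) \<psi>) \<sigma> + ?P \<phi>1 (?A (Seq C1 D1) \<psi>) \<sigma>)"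
    unfolding \<psi>0_def \<psi>1_def using C D by (subst (1 2) act_Seq_apply[OF _ _ \<psi>]) auto
  also have "\<dots> = ?A (qif2 \<phi>0 \<phi>1 q (Seq C0 D0) (Seq C1 D1)) \<psi>"
    by (rule act_qif2[OF wf(2) _ \<psi>, symmetric]) auto
  finally show "?A (Seq (qif2 \<phi>0 \<phi>1 q C0 C1) (qif2 \<phi>0 \<phi>1 q D0 D1)) \<psi> = ?A (qif2 \<phi>0 \<phi>1 q (Seq C0 D0) (Seq C1 D1)) \<psi>" .
qed

text \<open>\<open>C\<close> acts before both branches, so the law amounts to expanding the
  \<open>Qif\<close> at the vector \<open>act X T C \<psi>\<close> and regrouping each branch as a
  sequence.\<close>

lemma Seq_qif2_left_equiv:
  assumes wf: "wf_circ (Seq C (qif2 \<phi>0 \<phi>1 q C0 C1))" "wf_circ (qif2 \<phi>0 \<phi>1 q (Seq C C0) (Seq C C1))"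
  shows "circ_equiv X (Seq C (qif2 \<phi>0 \<phi>1 q C0 C1)) (qif2 \<phi>0 \<phi>1 q (Seq C C0) (Seq C C1))"
proof (rule circ_equivI[OF wf])
  let ?T = "{q} \<union> qv C \<union> qv C0 \<union> qv C1" and ?Q = "qif2 \<phi>0 \<phi>1 q C0 C1"
  show "?T = qv (Seq C ?Q) \<union> qv (qif2 \<phi>0 \<phi>1 q (Seq C C0) (Seq C C1))"
    by auto
  fix \<psi> assume \<psi>: "\<psi> \<in> ell2 (assigns X ?T)"
  let ?P = "guard X ?T [q]" and ?A = "act X ?T"
  have wfC: "wf_circ C" and wfQ: "wf_circ ?Q"
    using wf(1) by simp_all
  note C = qif2_wfD[OF wfQ]
  have in_C: "?A C \<psi> \<in> ell2 (assigns X ?T)"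
    by (rule bounded_on_ell2[OF bounded_on_act[OF wfC] \<psi>]) auto
  have "?A (Seq C ?Q) \<psi> = ?A ?Q (?A C \<psi>)"
    by (rule act_Seq_apply[OF wf(1) _ \<psi>]) auto
  also have "\<dots> = (\<lambda>\<sigma>. ?P \<phi>0 (?A C0 (?A C \<psi>)) \<sigma> + ?P \<phi>1 (?A C1 (?A C \<psi>)) \<sigma>)"
    by (rule act_qif2[OF wfQ _ in_C]) auto
  also have "\<dots> = (\<lambda>\<sigma>. ?P \<phi>0 (?A (Seq C C0) \<psi>) \<sigma> + ?P \<phi>1 (?A (Seq C C1) \<psi>) \<sigma>)"
    using C wfC by (subst (1 2) act_Seq_apply[OF _ _ \<psi>]) auto
  also have "\<dots> = ?A (qif2 \<phi>0 \<phi>1 q (Seq C C0) (Seq C C1)) \<psi>"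
    by (rule act_qif2[OF wf(2) _ \<psi>, symmetric]) auto
  finally show "?A (Seq C ?Q) \<psi> = ?A (qif2 \<phi>0 \<phi>1 q (Seq C C0) (Seq C C1)) \<psi>" .
qed

text \<open>Here \<open>C\<close> acts on the sum of the guarded branches: linearity distributes it,
  and commutation with the guards, from \<open>q \<notin> qv C\<close>, brings it inside each
  branch.\<close>

lemma Seq_qif2_right_equiv:
  assumes q: "q \<notin> qv C"
    and wf: "wf_circ (Seq (qif2 \<phi>0 \<phi>1 q C0 C1) C)" "wf_circ (qif2 \<phi>0 \<phi>1 q (Seq C0 C) (Seq C1 C))"
  shows "circ_equiv X (Seq (qif2 \<phi>0 \<phi>1 q C0 C1) C) (qif2 \<phi>0 \<phi>1 q (Seq C0 C) (Seq C1 C))"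
proof (rule circ_equivI[OF wf])
  let ?T = "{q} \<union> qv C \<union> qv C0 \<union> qv C1" and ?Q = "qif2 \<phi>0 \<phi>1 q C0 C1"
  show "?T = qv (Seq ?Q C) \<union> qv (qif2 \<phi>0 \<phi>1 q (Seq C0 C) (Seq C1 C))"
    by auto
  fix \<psi> assume \<psi>: "\<psi> \<in> ell2 (assigns X ?T)"
  let ?P = "guard X ?T [q]" and ?A = "act X ?T"
  have wfC: "wf_circ C" and wfQ: "wf_circ ?Q"
    using wf(1) by simp_all
  note C = qif2_wfD[OF wfQ]
  have bC: "bounded_on (assigns X ?T) (?A C)"
    by (rule bounded_on_act[OF wfC]) auto
  have in0: "?A C0 \<psi> \<in> ell2 (assigns X ?T)"
    by (rule bounded_on_ell2[OF bounded_on_act[OF C(1)] \<psi>]) auto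
  have in1: "?A C1 \<psi> \<in> ell2 (assigns X ?T)"
    by (rule bounded_on_ell2[OF bounded_on_act[OF C(2)] \<psi>]) auto
  have q': "distinct [q]" "set [q] \<subseteq> ?T"
    by auto
  note g0 = bounded_on_ell2[OF bounded_on_guard[OF q' C(5)] in0]
    and g1 = bounded_on_ell2[OF bounded_on_guard[OF q' C(6)] in1]
  have comm: "?A C (?P \<phi> \<xi>) = ?P \<phi> (?A C \<xi>)"
    if "\<phi> \<in> ell2 (reg_basis X [q])" "\<xi> \<in> ell2 (assigns X ?T)" for \<phi> \<xi>
    by (rule act_guard_commute[OF wfC _ _ q'(2) q'(1) that]) (use q in auto)
  have "?A (Seq ?Q C) \<psi> = ?A C (?A ?Q \<psi>)"
    by (rule act_Seq_apply[OF wf(1) _ \<psi>]) auto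
  also have "?A ?Q \<psi> = (\<lambda>\<sigma>. ?P \<phi>0 (?A C0 \<psi>) \<sigma> + ?P \<phi>1 (?A C1 \<psi>) \<sigma>)"
    by (rule act_qif2[OF wfQ _ \<psi>]) auto
  also have "?A C \<dots> = (\<lambda>\<sigma>. ?P \<phi>0 (?A C (?A C0 \<psi>)) \<sigma> + ?P \<phi>1 (?A C (?A C1 \<psi>)) \<sigma>)"
    unfolding bounded_on_add[OF bC g0 g1] comm[OF C(5) in0] comm[OF C(6) in1] ..
  also have "\<dots> = (\<lambda>\<sigma>. ?P \<phi>0 (?A (Seq C0 C) \<psi>) \<sigma> + ?P \<phi>1 (?A (Seq C1 C) \<psi>) \<sigma>)"
    using C wfC by (subst (1 2) act_Seq_apply[OF _ _ \<psi>]) auto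
  also have "\<dots> = ?A (qif2 \<phi>0 \<phi>1 q (Seq C0 C) (Seq C1 C)) \<psi>"
    by (rule act_qif2[OF wf(2) _ \<psi>, symmetric]) auto
  finally show "?A (Seq ?Q C) \<psi> = ?A (qif2 \<phi>0 \<phi>1 q (Seq C0 C) (Seq C1 C)) \<psi>" .
qed

end


theorem proposition4p2:
  fixes X :: "'v \<Rightarrow> 'x set" and \<U> :: "'x uconst set"
  assumes "\<forall>U\<in>\<U>. uconst_ok U"
  shows
    "(\<forall>C. well_formed X \<U> (Seq Skip C) \<longrightarrow> well_formed X \<U> (Seq C Skip) \<longrightarrow> well_formed X \<U> C \<longrightarrow>
        circ_equiv X (Seq Skip C) (Seq C Skip) \<and> circ_equiv X (Seq C Skip) C)
   \<and> (\<forall>qs. well_formed X \<U> (Gate (u_id (map X qs)) qs) \<longrightarrow>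
        circ_equiv X (Gate (u_id (map X qs)) qs) Skip)
   \<and> (\<forall>U1 U2 qs. u_mult U2 U1 \<in> \<U> \<longrightarrow>
        well_formed X \<U> (Seq (Gate U1 qs) (Gate U2 qs)) \<longrightarrow>
        well_formed X \<U> (Gate (u_mult U2 U1) qs) \<longrightarrow>
        circ_equiv X (Seq (Gate U1 qs) (Gate U2 qs)) (Gate (u_mult U2 U1) qs))
   \<and> (\<forall>U1 U2 qs rs. set qs \<inter> set rs = {} \<longrightarrow> u_tensor U1 U2 \<in> \<U> \<longrightarrow>
        well_formed X \<U> (Seq (Gate U1 qs) (Gate U2 rs)) \<longrightarrow>
        well_formed X \<U> (Seq (Gate U2 rs) (Gate U1 qs)) \<longrightarrow>
        well_formed X \<U> (Gate (u_tensor U1 U2) (qs @ rs)) \<longrightarrow>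
        circ_equiv X (Seq (Gate U1 qs) (Gate U2 rs)) (Seq (Gate U2 rs) (Gate U1 qs)) \<and>
        circ_equiv X (Seq (Gate U2 rs) (Gate U1 qs)) (Gate (u_tensor U1 U2) (qs @ rs)))
   \<and> (\<forall>C1 C2. qv C1 \<inter> qv C2 = {} \<longrightarrow>
        well_formed X \<U> (Seq C1 C2) \<longrightarrow> well_formed X \<U> (Seq C2 C1) \<longrightarrow>
        circ_equiv X (Seq C1 C2) (Seq C2 C1))
   \<and> (\<forall>C1 C2 C3.
        well_formed X \<U> (Seq (Seq C1 C2) C3) \<longrightarrow> well_formed X \<U> (Seq C1 (Seq C2 C3)) \<longrightarrow>
        circ_equiv X (Seq (Seq C1 C2) C3) (Seq C1 (Seq C2 C3)))
   \<and> (\<forall>q \<phi>0 \<phi>1 C0 C1 D0 D1. qubit X q \<longrightarrow> orthonormal_basis (reg_basis X [q]) [\<phi>0, \<phi>1] \<longrightarrow>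
        well_formed X \<U> (Seq (qif2 \<phi>0 \<phi>1 q C0 C1) (qif2 \<phi>0 \<phi>1 q D0 D1)) \<longrightarrow>
        well_formed X \<U> (qif2 \<phi>0 \<phi>1 q (Seq C0 D0) (Seq C1 D1)) \<longrightarrow>
        circ_equiv X (Seq (qif2 \<phi>0 \<phi>1 q C0 C1) (qif2 \<phi>0 \<phi>1 q D0 D1))
          (qif2 \<phi>0 \<phi>1 q (Seq C0 D0) (Seq C1 D1)))
   \<and> (\<forall>q \<phi>0 \<phi>1 C C0 C1. qubit X q \<longrightarrow> orthonormal_basis (reg_basis X [q]) [\<phi>0, \<phi>1] \<longrightarrow>
        q \<notin> qv C \<longrightarrow>
        (well_formed X \<U> (Seq C (qif2 \<phi>0 \<phi>1 q C0 C1)) \<longrightarrow>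
         well_formed X \<U> (qif2 \<phi>0 \<phi>1 q (Seq C C0) (Seq C C1)) \<longrightarrow>
         circ_equiv X (Seq C (qif2 \<phi>0 \<phi>1 q C0 C1)) (qif2 \<phi>0 \<phi>1 q (Seq C C0) (Seq C C1))) \<and>
        (well_formed X \<U> (Seq (qif2 \<phi>0 \<phi>1 q C0 C1) C) \<longrightarrow>
         well_formed X \<U> (qif2 \<phi>0 \<phi>1 q (Seq C0 C) (Seq C1 C)) \<longrightarrow>
         circ_equiv X (Seq (qif2 \<phi>0 \<phi>1 q C0 C1) C) (qif2 \<phi>0 \<phi>1 q (Seq C0 C) (Seq C1 C))))"
proof -
  interpret gate_set X \<U>
    by unfold_locales (rule assms)
  show ?thesis
    \<comment> \<open>\<open>Seq_commute_equiv\<close> serves both commutativity and the first half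
      of parallel composition. In the latter its premise speaks of \<open>qv\<close> of gates, so
      \<open>simp\<close> has to reduce it to the registers; \<open>fail\<close> rejects attempts
      that leave a goal open.\<close>
    by (intro conjI allI impI;
        ((rule Skip_Seq_equiv; assumption) | (rule Seq_Skip_equiv; assumption) |
         (rule Gate_id_equiv; assumption) | (rule Gate_mult_equiv; assumption) |
         (rule Gate_tensor_equiv; assumption) | (rule Seq_commute_equiv; simp; fail) |
         (rule Seq_assoc_equiv; assumption) | (rule qif2_Seq_equiv; assumption) |
         (rule Seq_qif2_left_equiv; assumption) | (rule Seq_qif2_right_equiv; assumption)))
qed

end
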